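(* Let $p$ be a prime and let $G$ be a $p$-adic analytic pro-$p$ group of dimension $d\ge1$. Let $j\in\mathbb{N}$ be such that $U=P_j(G)$ is uniformly powerful, and let $x_1,\ldots,x_d$ be a minimal generating system for $U$, let $\xi_1,\ldots,\xi_d$ be rational numbers with $\frac1d\le\xi_1\le\ldots\le\xi_d\le1$, and let $c\in\mathbb{N}_0$ be such that for all $i\in\mathbb{N}$ with $i\ge\max\{j+2cd,\,6cd\}$ the products of procyclic subgroups $$\check{U}_i=\overline{\langle x_1^{\,p^{\lfloor(i-j)\xi_1\rfloor+c}}\rangle}\cdots\overline{\langle x_d^{\,p^{\lfloor(i-j)\xi_d\rfloor+c}}\rangle},\qquad \hat{U}_i=\overline{\langle x_1^{\,p^{\lfloor(i-j)\xi_1\rfloor-c}}\rangle}\cdots\overline{\langle x_d^{\,p^{\lfloor(i-j)\xi_d\rfloor-c}}\rangle}$$ are open normal subgroups of $G$ with $\check{U}_i\subseteq P_i(G)\subseteq\hat{U}_i$ and $\hat{U}_i/\check{U}_i$ homocyclic abelian of exponent $p^{2c}$. Put $\sigma=\sum_{k=1}^d\xi_k\in[1,d]$. Then for all $i\in\mathbb{N}$ with $i\ge\max\{j+2cd,\,6cd\}$, the index of $P_i(G)$ in $G$ satisfies $$\Bigl|\log_p|G:P_i(G)|-\bigl(\log_p|G:P_j(G)|+\lfloor(i-j)\sigma\rfloor\bigr)\Bigr|\le d(c+1).$$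
   Context: $\mathbb{N}=\{1,2,\ldots\}$, $\mathbb{N}_0=\mathbb{N}\cup\{0\}$. The lower $p$-series of a finitely generated pro-$p$ group $G$ is defined by $P_1(G)=G$ and $P_i(G)=\overline{P_{i-1}(G)^p[P_{i-1}(G),G]}$ for $i\ge2$, where the bar denotes topological closure. A pro-$p$ group $U$ is uniformly powerful (uniform) if it is topologically finitely generated, powerful (i.e. $[U,U]\subseteq\overline{U^p}$, respectively $[U,U]\subseteq\overline{U^4}$ if $p=2$) and torsion-free. Generating systems of $U$ are understood topologically. The dimension of a $p$-adic analytic pro-$p$ group is its dimension as a $p$-adic analytic group; it equals the rank (minimal number of topological generators) of any uniformly powerful open subgroup. A finite abelian group is homocyclic if it is a direct product of cyclic groups of the same order. *)

theory Defs
  imports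
    "HOL-Analysis.Analysis"
    "HOL-Algebra.QuotRing"
    "HOL-Algebra.Generated_Groups"
    "HOL-Algebra.Elementary_Groups"
    "HOL-Algebra.Product_Groups"
    "HOL-Computational_Algebra.Primes"
begin

section \<open>The field of p-adic numbers\<close>

text \<open>Since \<open>p\<close> is a variable, the p-adic numbers form a carrier rather than a type: the
  completion of the rationals for the p-adic absolute value, i.e. Cauchy sequences modulo
  null sequences.\<close>

definition padic_val :: "nat \<Rightarrow> rat \<Rightarrow> int" where
  "padic_val p x =
     (case quotient_of x of (a, b) \<Rightarrow> int (multiplicity (int p) a) - int (multiplicity (int p) b))"

definition padic_abs :: "nat \<Rightarrow> rat \<Rightarrow> real" where
  "padic_abs p x = (if x = 0 then 0 else real p powi (- padic_val p x))"

definition padic_Cauchy_ring :: "nat \<Rightarrow> (nat \<Rightarrow> rat) ring" where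
  "padic_Cauchy_ring p =
     \<lparr>carrier = {f. \<forall>e>0. \<exists>N. \<forall>m\<ge>N. \<forall>n\<ge>N. padic_abs p (f m - f n) < e},
      monoid.mult = (\<lambda>f g n. f n * g n), monoid.one = (\<lambda>_. 1),
      ring.zero = (\<lambda>_. 0), ring.add = (\<lambda>f g n. f n + g n)\<rparr>"

definition padic_null :: "nat \<Rightarrow> (nat \<Rightarrow> rat) set" where
  "padic_null p = {f. (\<lambda>n. padic_abs p (f n)) \<longlonglongrightarrow> 0}"

type_synonym padic = "(nat \<Rightarrow> rat) set"

definition Qp :: "nat \<Rightarrow> padic ring" where
  "Qp p = padic_Cauchy_ring p Quot padic_null p"

definition Qp_norm :: "nat \<Rightarrow> padic \<Rightarrow> real" where
  "Qp_norm p u = (THE r. \<forall>f\<in>u. (\<lambda>n. padic_abs p (f n)) \<longlonglongrightarrow> r)"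

text \<open>The value off the carrier is fixed because the locale \<open>Metric_space\<close> asks for
  symmetry and nonnegativity on the whole type.\<close>

definition Qp_dist :: "nat \<Rightarrow> padic \<Rightarrow> padic \<Rightarrow> real" where
  "Qp_dist p u v =
     (if u \<in> carrier (Qp p) \<and> v \<in> carrier (Qp p) then Qp_norm p (u \<ominus>\<^bsub>Qp p\<^esub> v) else 0)"

definition Qp_topology :: "nat \<Rightarrow> padic topology" where
  "Qp_topology p = Metric_space.mtopology (carrier (Qp p)) (Qp_dist p)"

definition Zp :: "nat \<Rightarrow> padic set" where
  "Zp p = {u \<in> carrier (Qp p). Qp_norm p u \<le> 1}"

definition Zp_power :: "nat \<Rightarrow> nat \<Rightarrow> (nat \<Rightarrow> padic) topology" where
  "Zp_power p n = product_topology (\<lambda>_. subtopology (Qp_topology p) (Zp p)) {..<n}"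


section \<open>p-adic analytic functions, manifolds and groups\<close>

definition multi_indices :: "nat \<Rightarrow> (nat \<Rightarrow> nat) set" where
  "multi_indices r = {..<r} \<rightarrow>\<^sub>E UNIV"

text \<open>Convergence is along the net of finite sets of multi-indices, so no enumeration of the
  multi-indices is chosen.\<close>

definition power_series_converges_to ::
  "nat \<Rightarrow> nat \<Rightarrow> ((nat \<Rightarrow> nat) \<Rightarrow> padic) \<Rightarrow> (nat \<Rightarrow> padic) \<Rightarrow> padic \<Rightarrow> bool" where
  "power_series_converges_to p r a x s \<longleftrightarrow>
     limitin (Qp_topology p)
       (\<lambda>F. finsum (Qp p)
          (\<lambda>\<alpha>. a \<alpha> \<otimes>\<^bsub>Qp p\<^esub> finprod (Qp p) (\<lambda>k. x k [^]\<^bsub>Qp p\<^esub> \<alpha> k) {..<r}) F)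
       s (finite_subsets_at_top (multi_indices r))"

definition scaled_point ::
  "nat \<Rightarrow> nat \<Rightarrow> (nat \<Rightarrow> padic) \<Rightarrow> nat \<Rightarrow> (nat \<Rightarrow> padic) \<Rightarrow> nat \<Rightarrow> padic" where
  "scaled_point p r y h x = (\<lambda>k\<in>{..<r}. y k \<oplus>\<^bsub>Qp p\<^esub> add_pow (Qp p) (p ^ h) (x k))"

text \<open>For \<open>V\<close> an open subset of \<open>Zp\<^sup>r\<close>, a map \<open>f\<close> from \<open>V\<close> to \<open>Zp\<^sup>s\<close> is analytic if near each
  point \<open>y\<close> it satisfies \<open>f (y + p\<^sup>h x) = F(x)\<close> for all \<open>x \<in> Zp\<^sup>r\<close>, with \<open>F\<close> an \<open>s\<close>-tuple of
  formal power series over \<open>Qp\<close> in \<open>r\<close> variables.\<close>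

definition padic_analytic ::
  "nat \<Rightarrow> nat \<Rightarrow> nat \<Rightarrow> (nat \<Rightarrow> padic) set \<Rightarrow> ((nat \<Rightarrow> padic) \<Rightarrow> nat \<Rightarrow> padic) \<Rightarrow> bool" where
  "padic_analytic p r s V f \<longleftrightarrow>
     (\<forall>y\<in>V. \<exists>h::nat.
        (\<forall>x\<in>topspace (Zp_power p r). scaled_point p r y h x \<in> V) \<and>
        (\<forall>i<s. \<exists>a. a \<in> multi_indices r \<rightarrow> carrier (Qp p) \<and>
           (\<forall>x\<in>topspace (Zp_power p r).
              power_series_converges_to p r a x (f (scaled_point p r y h x) i))))"

type_synonym 'a chart = "'a set \<times> ('a \<Rightarrow> nat \<Rightarrow> padic)"

definition is_chart :: "nat \<Rightarrow> nat \<Rightarrow> 'a topology \<Rightarrow> 'a chart \<Rightarrow> bool" where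
  "is_chart p n M = (\<lambda>(U, \<phi>).
     openin M U \<and> openin (Zp_power p n) (\<phi> ` U) \<and>
     homeomorphic_map (subtopology M U) (subtopology (Zp_power p n) (\<phi> ` U)) \<phi>)"

definition chart_transition_analytic :: "nat \<Rightarrow> nat \<Rightarrow> 'a chart \<Rightarrow> 'a chart \<Rightarrow> bool" where
  "chart_transition_analytic p n = (\<lambda>(U, \<phi>) (V, \<psi>).
     padic_analytic p n n (\<phi> ` (U \<inter> V)) (\<psi> \<circ> inv_into U \<phi>))"

definition padic_atlas :: "nat \<Rightarrow> nat \<Rightarrow> 'a topology \<Rightarrow> 'a chart set \<Rightarrow> bool" where
  "padic_atlas p n M A \<longleftrightarrow>
     (\<forall>c\<in>A. is_chart p n M c) \<and> \<Union>(fst ` A) = topspace M \<and>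
     (\<forall>c\<in>A. \<forall>c'\<in>A. chart_transition_analytic p n c c')"

definition padic_analytic_map ::
  "nat \<Rightarrow> nat \<Rightarrow> 'a topology \<Rightarrow> 'a chart set \<Rightarrow> nat \<Rightarrow> 'b chart set \<Rightarrow> ('a \<Rightarrow> 'b) \<Rightarrow> bool" where
  "padic_analytic_map p m M A n B f \<longleftrightarrow>
     (\<forall>(U, \<phi>)\<in>A. \<forall>(V, \<psi>)\<in>B.
        openin M {x \<in> topspace M. f x \<in> V} \<and>
        padic_analytic p m n (\<phi> ` {x \<in> U. f x \<in> V}) (\<psi> \<circ> f \<circ> inv_into U \<phi>))"

text \<open>\<open>Zp\<^sup>m \<times> Zp\<^sup>n\<close> is identified with \<open>Zp\<^sup>m\<^sup>+\<^sup>n\<close> by concatenation.\<close>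

definition product_atlas ::
  "nat \<Rightarrow> 'a chart set \<Rightarrow> nat \<Rightarrow> 'b chart set \<Rightarrow> ('a \<times> 'b) chart set" where
  "product_atlas m A n B =
     {(U \<times> V, \<lambda>(x, y). \<lambda>k\<in>{..<m + n}. if k < m then \<phi> x k else \<psi> y (k - m)) | U \<phi> V \<psi>.
        (U, \<phi>) \<in> A \<and> (V, \<psi>) \<in> B}"

definition topological_group :: "('a, 'b) monoid_scheme \<Rightarrow> 'a topology \<Rightarrow> bool" where
  "topological_group G T \<longleftrightarrow>
     group G \<and> topspace T = carrier G \<and>
     continuous_map (prod_topology T T) T (\<lambda>(x, y). x \<otimes>\<^bsub>G\<^esub> y) \<and>
     continuous_map T T (\<lambda>x. inv\<^bsub>G\<^esub> x)"

text \<open>The parameter \<open>d\<close> is the dimension of the underlying manifold: all charts take values in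
  \<open>Zp\<^sup>d\<close>.\<close>

definition padic_analytic_group ::
  "nat \<Rightarrow> nat \<Rightarrow> ('a, 'b) monoid_scheme \<Rightarrow> 'a topology \<Rightarrow> bool" where
  "padic_analytic_group p d G T \<longleftrightarrow>
     topological_group G T \<and>
     (\<exists>A. padic_atlas p d T A \<and>
        padic_analytic_map p (d + d) (prod_topology T T) (product_atlas d A d A) d A
          (\<lambda>(x, y). x \<otimes>\<^bsub>G\<^esub> y) \<and>
        padic_analytic_map p d T A d A (\<lambda>x. inv\<^bsub>G\<^esub> x))"


section \<open>Pro-p groups\<close>

definition profinite_group :: "('a, 'b) monoid_scheme \<Rightarrow> 'a topology \<Rightarrow> bool" where
  "profinite_group G T \<longleftrightarrow>
     topological_group G T \<and> compact_space T \<and> Hausdorff_space T \<and>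
     (\<forall>V. openin T V \<and> \<one>\<^bsub>G\<^esub> \<in> V \<longrightarrow> (\<exists>H. subgroup H G \<and> openin T H \<and> H \<subseteq> V))"

definition group_index :: "('a, 'b) monoid_scheme \<Rightarrow> 'a set \<Rightarrow> nat" where
  "group_index G H = card (rcosets\<^bsub>G\<^esub> H)"

definition pro_p_group :: "nat \<Rightarrow> ('a, 'b) monoid_scheme \<Rightarrow> 'a topology \<Rightarrow> bool" where
  "pro_p_group p G T \<longleftrightarrow>
     profinite_group G T \<and>
     (\<forall>N. N \<lhd> G \<and> openin T N \<longrightarrow> (\<exists>k. group_index G N = p ^ k))"

definition topologically_generates ::
  "('a, 'b) monoid_scheme \<Rightarrow> 'a topology \<Rightarrow> 'a set \<Rightarrow> bool" where
  "topologically_generates G T S \<longleftrightarrow>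
     S \<subseteq> carrier G \<and> T closure_of (generate G S) = carrier G"

definition topologically_fin_gen :: "('a, 'b) monoid_scheme \<Rightarrow> 'a topology \<Rightarrow> bool" where
  "topologically_fin_gen G T \<longleftrightarrow> (\<exists>S. finite S \<and> topologically_generates G T S)"

text \<open>Minimality is with respect to omitting members of the family \<open>x\<^sub>1, \<dots>, x\<^sub>d\<close>; in particular
  it forces the members to be distinct.\<close>

definition minimal_generating_system ::
  "('a, 'b) monoid_scheme \<Rightarrow> 'a topology \<Rightarrow> nat \<Rightarrow> (nat \<Rightarrow> 'a) \<Rightarrow> bool" where
  "minimal_generating_system G T d x \<longleftrightarrow>
     topologically_generates G T (x ` {1..d}) \<and>
     (\<forall>I. I \<subset> {1..d} \<longrightarrow> \<not> topologically_generates G T (x ` I))"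

definition commutator_subgroup ::
  "('a, 'b) monoid_scheme \<Rightarrow> 'a set \<Rightarrow> 'a set \<Rightarrow> 'a set" where
  "commutator_subgroup G H K =
     generate G {h \<otimes>\<^bsub>G\<^esub> k \<otimes>\<^bsub>G\<^esub> inv\<^bsub>G\<^esub> h \<otimes>\<^bsub>G\<^esub> inv\<^bsub>G\<^esub> k | h k. h \<in> H \<and> k \<in> K}"

definition power_subgroup :: "('a, 'b) monoid_scheme \<Rightarrow> 'a set \<Rightarrow> nat \<Rightarrow> 'a set" where
  "power_subgroup G H n = generate G ((\<lambda>h. h [^]\<^bsub>G\<^esub> n) ` H)"

text \<open>The lower p-series is indexed from 1; the value at 0 is a dummy.\<close>

fun lower_p_series ::
  "nat \<Rightarrow> ('a, 'b) monoid_scheme \<Rightarrow> 'a topology \<Rightarrow> nat \<Rightarrow> 'a set" where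
  "lower_p_series p G T 0 = carrier G"
| "lower_p_series p G T (Suc 0) = carrier G"
| "lower_p_series p G T (Suc (Suc i)) =
     T closure_of
       (power_subgroup G (lower_p_series p G T (Suc i)) p <#>\<^bsub>G\<^esub>
        commutator_subgroup G (lower_p_series p G T (Suc i)) (carrier G))"

definition powerful :: "nat \<Rightarrow> ('a, 'b) monoid_scheme \<Rightarrow> 'a topology \<Rightarrow> bool" where
  "powerful p G T \<longleftrightarrow>
     commutator_subgroup G (carrier G) (carrier G) \<subseteq>
       T closure_of (power_subgroup G (carrier G) (if p = 2 then 4 else p))"

definition torsion_free :: "('a, 'b) monoid_scheme \<Rightarrow> bool" where
  "torsion_free G \<longleftrightarrow>
     (\<forall>x\<in>carrier G. \<forall>n::nat. 0 < n \<and> x [^]\<^bsub>G\<^esub> n = \<one>\<^bsub>G\<^esub> \<longrightarrow> x = \<one>\<^bsub>G\<^esub>)"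

definition uniformly_powerful :: "nat \<Rightarrow> ('a, 'b) monoid_scheme \<Rightarrow> 'a topology \<Rightarrow> bool" where
  "uniformly_powerful p G T \<longleftrightarrow>
     pro_p_group p G T \<and> topologically_fin_gen G T \<and> powerful p G T \<and> torsion_free G"

definition procyclic_subgroup ::
  "('a, 'b) monoid_scheme \<Rightarrow> 'a topology \<Rightarrow> 'a \<Rightarrow> 'a set" where
  "procyclic_subgroup G T y = T closure_of (generate G {y})"

text \<open>The ordered product set of the procyclic subgroups generated by \<open>y\<^sub>1, \<dots>, y\<^sub>d\<close>.\<close>

definition procyclic_product ::
  "('a, 'b) monoid_scheme \<Rightarrow> 'a topology \<Rightarrow> nat \<Rightarrow> (nat \<Rightarrow> 'a) \<Rightarrow> 'a set" where
  "procyclic_product G T d y =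
     foldr (\<lambda>k S. procyclic_subgroup G T (y k) <#>\<^bsub>G\<^esub> S) [1..<Suc d] {\<one>\<^bsub>G\<^esub>}"


section \<open>Homocyclic groups\<close>

definition homocyclic :: "('a, 'b) monoid_scheme \<Rightarrow> bool" where
  "homocyclic Q \<longleftrightarrow>
     comm_group Q \<and> finite (carrier Q) \<and>
     (\<exists>(m::nat) (n::nat). 0 < n \<and> Q \<cong> product_group {..<m} (\<lambda>_. integer_mod_group n))"

definition group_exponent :: "('a, 'b) monoid_scheme \<Rightarrow> nat" where
  "group_exponent Q = (LEAST n. 0 < n \<and> (\<forall>x\<in>carrier Q. x [^]\<^bsub>Q\<^esub> n = \<one>\<^bsub>Q\<^esub>))"

end

theory Submission
  imports
    Defs
    "HOL-Algebra.Group_Action"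
    "HOL-Algebra.Multiplicative_Group"
    "HOL-Algebra.Zassenhaus"
begin

text \<open>In the uniform group \<open>U\<close>, with lower p-series \<open>U = U\<^sub>1, U\<^sub>2, \<dots>\<close>, raising to the \<open>p\<close>-th
  power induces isomorphisms from each layer \<open>U\<^sub>n / U\<^sub>n\<^sub>+\<^sub>1\<close> to the next: surjectivity comes from
  powerfulness, injectivity from torsion-freeness. Together with the Frattini argument at the first
  layer, every element of \<open>U\<close> is uniquely \<open>x\<^sub>1 ^ e\<^sub>1 \<cdots> x\<^sub>d ^ e\<^sub>d\<close> modulo \<open>U\<^sub>n\<^sub>+\<^sub>1\<close> with all exponents below
  \<open>p ^ n\<close>. Hence an open normal subgroup that is the product of the procyclic groups generated by
  the \<open>x\<^sub>k ^ (p ^ m\<^sub>k)\<close> has index exactly \<open>p ^ (m\<^sub>1 + \<dots> + m\<^sub>d)\<close> in \<open>U\<close>. This gives the indices of the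
  two subgroups enclosing \<open>P\<^sub>i(G)\<close>; the sum of the floors differs from the floor of the sum by at
  most \<open>d\<close>.\<close>

text \<open>The definition of uniformity asks for torsion-freeness and says nothing about the sizes
  of the layers, so their equality has to be derived. The obstacle is that taking
  \<open>p\<close>-th powers is multiplicative only up to commutators: collecting
  \<open>(x z)^p\<close> leaves \<open>x^p z^p c^(p(p-1)/2)\<close> with \<open>c\<close> a
  commutator. For odd \<open>p\<close> the last exponent is a multiple of \<open>p\<close>, which
  pushes that factor one layer down. For \<open>p = 2\<close> it is 1, and commutators must lie one
  layer deeper from the start; this is what the fourth powers in the definition of powerful provide.

  Exponents remain natural numbers throughout: a procyclic group is only ever compared with the
  cosets of some \<open>W n\<close>, so powers with p-adic exponents are never formed.

  In the final bound, \<open>d * c\<close> is the total shift of the \<open>d\<close> exponents by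
  \<open>c\<close>, and the further \<open>d\<close> pays for rounding.\<close>

section \<open>Cosets, indices and finite p-groups\<close>

lemma (in group) mult_inv_cancel:
  assumes "x \<in> carrier G" "y \<in> carrier G"
  shows "x \<otimes> (inv x \<otimes> y) = y" "inv x \<otimes> (x \<otimes> y) = y"
  using assms by (simp_all flip: m_assoc)

text \<open>Collection in nilpotency class 2. Each \<open>z\<close> is moved to the right across
  every \<open>x\<close> that follows it; each crossing leaves one factor \<open>c\<close>, which
  commutes with both, and there are \<open>n * (n - 1) div 2\<close> crossings.\<close>

lemma (in group) collect_mult_pow:
  assumes x: "x \<in> carrier G" and z: "z \<in> carrier G" and c: "c \<in> carrier G"
    and zx: "z \<otimes> x = x \<otimes> z \<otimes> c" and cx: "c \<otimes> x = x \<otimes> c" and cz: "c \<otimes> z = z \<otimes> c"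
  shows "(x \<otimes> z) [^] (n::nat) = x [^] n \<otimes> z [^] n \<otimes> c [^] (n * (n - 1) div 2)"
proof (induction n)
  case 0
  show ?case by simp
next
  case (Suc n)
  have pow_comm: "a [^] (m::nat) \<otimes> b = b \<otimes> a [^] m"
    if "a \<in> carrier G" "b \<in> carrier G" "a \<otimes> b = b \<otimes> a" for a b m
  proof (induction m)
    case (Suc m)
    then show ?case using that by (metis m_assoc nat_pow_Suc nat_pow_closed)
  qed (use that in simp)
  have zn: "z [^] m \<otimes> x = x \<otimes> z [^] m \<otimes> c [^] m" for m :: nat
  proof (induction m)
    case (Suc m)
    have "z [^] Suc m \<otimes> x = z [^] m \<otimes> (x \<otimes> z \<otimes> c)"
      using x z c zx by (simp add: m_assoc)
    also have "\<dots> = (z [^] m \<otimes> x) \<otimes> z \<otimes> c"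
      using x z c by (simp add: m_assoc)
    also have "\<dots> = x \<otimes> z [^] m \<otimes> (c [^] m \<otimes> z) \<otimes> c"
      using x z c by (simp add: Suc m_assoc)
    also have "\<dots> = x \<otimes> z [^] m \<otimes> (z \<otimes> c [^] m) \<otimes> c"
      using pow_comm[OF c z cz] by simp
    also have "\<dots> = x \<otimes> z [^] Suc m \<otimes> c [^] Suc m"
      using x z c by (simp add: m_assoc)
    finally show ?case .
  qed (use x in simp)
  have ck: "c [^] k \<otimes> (x \<otimes> z) = x \<otimes> z \<otimes> c [^] k" for k :: nat
    using pow_comm[OF c, of "x \<otimes> z"] x z c cx cz by (metis m_assoc m_closed)
  let ?k = "n * (n - 1) div 2"
  have k: "Suc n * (Suc n - 1) div 2 = n + ?k"
    by (cases n) (auto simp: algebra_simps)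
  have "(x \<otimes> z) [^] Suc n = x [^] n \<otimes> z [^] n \<otimes> (c [^] ?k \<otimes> (x \<otimes> z))"
    using x z c Suc by (simp add: m_assoc)
  also have "\<dots> = x [^] n \<otimes> (z [^] n \<otimes> x) \<otimes> z \<otimes> c [^] ?k"
    using x z c by (simp add: ck m_assoc)
  also have "\<dots> = x [^] n \<otimes> x \<otimes> z [^] n \<otimes> (c [^] n \<otimes> z) \<otimes> c [^] ?k"
    using x z c by (simp add: zn m_assoc)
  also have "\<dots> = x [^] n \<otimes> x \<otimes> z [^] n \<otimes> (z \<otimes> c [^] n) \<otimes> c [^] ?k"
    using pow_comm[OF c z cz] by simp
  also have "\<dots> = x [^] Suc n \<otimes> z [^] Suc n \<otimes> (c [^] n \<otimes> c [^] ?k)"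
    using x z c by (simp add: m_assoc)
  also have "c [^] n \<otimes> c [^] ?k = c [^] (Suc n * (Suc n - 1) div 2)"
    using c by (simp only: nat_pow_mult k)
  finally show ?case .
qed

lemma (in subgroup) coset_eq_iff:
  assumes "group G" "a \<in> carrier G" "b \<in> carrier G"
  shows "H #> a = H #> b \<longleftrightarrow> a \<otimes> inv b \<in> H"
proof -
  interpret group G by fact
  show ?thesis
    using assms(2,3) rcos_module[OF group_axioms, of b a] repr_independence[of a H b]
      rcos_self[of a H] subgroup_axioms by blast
qed

text \<open>Calculations in a quotient are mostly written as equations between cosets of
  representatives in \<open>G\<close>. This congruence and the next one allow a factor to be
  replaced by one that agrees with it modulo \<open>H\<close>.\<close>

lemma (in normal) coset_mult_cong:
  assumes "a \<in> carrier G" "a' \<in> carrier G" "b \<in> carrier G" "b' \<in> carrier G"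
    and "H #> a = H #> a'" "H #> b = H #> b'"
  shows "H #> (a \<otimes> b) = H #> (a' \<otimes> b')"
  using assms by (metis rcos_sum)

lemma (in normal) coset_inv_cong:
  assumes "a \<in> carrier G" "a' \<in> carrier G" "H #> a = H #> a'"
  shows "H #> inv a = H #> inv a'"
  using assms by (metis rcos_inv)

lemma (in normal) coset_comm_iff:
  assumes "a \<in> carrier G" "b \<in> carrier G"
  shows "H #> (a \<otimes> b) = H #> (b \<otimes> a) \<longleftrightarrow> a \<otimes> b \<otimes> inv a \<otimes> inv b \<in> H"
  using assms by (subst coset_eq_iff[OF is_group]) (auto simp: inv_mult_group m_assoc)

text \<open>A coset of \<open>K\<close> is a coset of \<open>K\<close> inside \<open>H\<close>,
  translated by a chosen representative of the coset of \<open>H\<close> around it. This is a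
  bijection with a product of sets, so infinite indices are covered too, \<open>card\<close> being 0
  on infinite sets.\<close>

lemma (in group) card_rcosets_mult:
  assumes K: "subgroup K G" and H: "subgroup H G" and KH: "K \<subseteq> H"
  shows "card (rcosets K) = card (rcosets H) * card (rcosets\<^bsub>G\<lparr>carrier := H\<rparr>\<^esub> K)"
proof -
  define rep where "rep R = (SOME r. r \<in> R)" for R :: "'a set"
  have rep: "rep R \<in> R" "rep R \<in> carrier G" "H #> rep R = R" if "R \<in> rcosets H" for R
  proof -
    have "R \<noteq> {}" using subgroup.rcosets_non_empty[OF H that] .
    then show 1: "rep R \<in> R" unfolding rep_def by (meson ex_in_conv someI)
    show 2: "rep R \<in> carrier G"
      using subgroup.rcosets_carrier[OF H group_axioms that] 1 by blast
    obtain g where "g \<in> carrier G" "R = H #> g" using \<open>R \<in> rcosets H\<close> by (auto simp: RCOSETS_def)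
    then show "H #> rep R = R" using 1 repr_independence[OF _ _ H] by metis
  qed
  let ?S = "rcosets\<^bsub>G\<lparr>carrier := H\<rparr>\<^esub> K"
  have S: "\<exists>h\<in>H. X = K #> h" if "X \<in> ?S" for X
    using that by (auto simp: RCOSETS_def)
  have sub: "H \<subseteq> carrier G" "K \<subseteq> carrier G"
    using subgroup.subset H K by auto
  let ?f = "\<lambda>(R, X). X #> rep R"
  have "bij_betw ?f ((rcosets H) \<times> ?S) (rcosets K)"
  proof (rule bij_betw_imageI)
    show "inj_on ?f ((rcosets H) \<times> ?S)"
    proof (rule inj_onI, clarify)
      fix R X R' X'
      assume R: "R \<in> rcosets H" "R' \<in> rcosets H" and X: "X \<in> ?S" "X' \<in> ?S"
        and eq: "X #> rep R = X' #> rep R'"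
      obtain h h' where h: "h \<in> H" "X = K #> h" "h' \<in> H" "X' = K #> h'"
        using S X by metis
      have hc: "h \<in> carrier G" "h' \<in> carrier G" using h sub by auto
      have e: "K #> (h \<otimes> rep R) = K #> (h' \<otimes> rep R')"
        using eq h(2,4) hc rep(2) R sub(2) by (simp add: coset_mult_assoc)
      have "h \<otimes> rep R \<otimes> inv (h' \<otimes> rep R') \<in> K"
        using e subgroup.coset_eq_iff[OF K group_axioms] hc rep(2) R by simp
      then have "h \<otimes> rep R \<otimes> inv (h' \<otimes> rep R') \<in> H" using KH by auto
      then have "H #> (h \<otimes> rep R) = H #> (h' \<otimes> rep R')"
        using subgroup.coset_eq_iff[OF H group_axioms] hc rep(2) R by simp
      moreover have "H #> (h \<otimes> rep R) = R" if "h \<in> H" "R \<in> rcosets H" for h R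
      proof -
        have "H #> (h \<otimes> rep R) = H #> h #> rep R"
          using that rep(2)[OF that(2)] sub(1) by (simp add: coset_mult_assoc[of H h "rep R"] subsetD)
        also have "H #> h = H" using coset_join2[OF _ H] that(1) sub(1) by blast
        finally show ?thesis using rep(3)[OF that(2)] by simp
      qed
      ultimately have RR: "R = R'" using h R by metis
      have "h \<otimes> rep R \<otimes> inv (h' \<otimes> rep R) = h \<otimes> inv h'"
        using hc rep(2)[OF R(1)] by (simp add: inv_mult_group m_assoc mult_inv_cancel)
      then have "h \<otimes> inv h' \<in> K"
        using \<open>h \<otimes> rep R \<otimes> inv (h' \<otimes> rep R') \<in> K\<close> RR by simp
      then have "X = X'"
        using subgroup.coset_eq_iff[OF K group_axioms hc] h by simp
      then show "R = R' \<and> X = X'" using RR by simp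
    qed
    show "?f ` ((rcosets H) \<times> ?S) = rcosets K"
    proof (rule equalityI; rule subsetI)
      fix Y assume "Y \<in> ?f ` ((rcosets H) \<times> ?S)"
      then obtain R X where R: "R \<in> rcosets H" and "X \<in> ?S" "Y = X #> rep R" by auto
      then obtain h where "h \<in> H" "Y = K #> h #> rep R" using S by metis
      then show "Y \<in> rcosets K"
        using rep(2)[OF R] sub by (auto simp: coset_mult_assoc subset_iff intro!: rcosetsI)
    next
      fix Y assume "Y \<in> rcosets K"
      then obtain g where g: "g \<in> carrier G" "Y = K #> g" by (auto simp: RCOSETS_def)
      let ?R = "H #> g"
      have R: "?R \<in> rcosets H" using g sub rcosetsI by auto
      then have "g \<in> H #> rep ?R" using rep(3) rcos_self[OF g(1) H] by simp
      then have h: "g \<otimes> inv (rep ?R) \<in> H"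
        using subgroup.rcos_module[OF H group_axioms] rep(2)[OF R] g by blast
      have "Y = K #> (g \<otimes> inv (rep ?R)) #> rep ?R"
        using g sub rep(2)[OF R] by (simp add: coset_mult_assoc m_assoc)
      moreover have "K #> (g \<otimes> inv (rep ?R)) \<in> ?S"
        using h by (auto simp: RCOSETS_def)
      ultimately show "Y \<in> ?f ` ((rcosets H) \<times> ?S)" using R by force
    qed
  qed
  then show ?thesis
    by (metis bij_betw_same_card card_cartesian_product)
qed

text \<open>The class equation for the conjugation action: the one-point orbits are the central
  elements, and their number is a positive multiple of \<open>p\<close>, so a nontrivial one exists.
  A suitable power of it has order \<open>p\<close>.\<close>

lemma (in group) p_group_central_element:
  assumes p: "prime p" and ord: "order G = p ^ k" and k: "k > 0"
  obtains z where "z \<in> carrier G" "z \<noteq> \<one>" "z [^] p = \<one>"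
    "\<And>u. u \<in> carrier G \<Longrightarrow> z \<otimes> u = u \<otimes> z"
proof -
  define \<phi> where "\<phi> = (\<lambda>g. \<lambda>h\<in>carrier G. g \<otimes> h \<otimes> inv g)"
  interpret act: group_action G "carrier G" \<phi>
    unfolding \<phi>_def by (rule action_by_conjugation)
  define Z where "Z = {z \<in> carrier G. \<forall>u\<in>carrier G. z \<otimes> u = u \<otimes> z}"
  have fin: "finite (carrier G)"
    using ord p order_gt_0_iff_finite by (simp add: prime_gt_0_nat)
  let ?O = "orbits G (carrier G) \<phi>"
  have finO: "finite ?O"
    using fin by (auto simp: orbits_def)
  have "card (carrier G) = card (\<Union> ?O)"
    using act.orbits_coverture by simp
  also have "\<dots> = (\<Sum>C\<in>?O. card C)"
  proof (rule card_Union_disjoint)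
    show "pairwise disjnt ?O"
    proof (rule pairwiseI)
      fix A B assume "A \<in> ?O" "B \<in> ?O" "A \<noteq> B"
      then show "disjnt A B" using act.disjoint_union[of A B] by (simp add: disjnt_def)
    qed
    fix A assume "A \<in> ?O"
    then have "A \<subseteq> carrier G" using act.orbits_coverture by blast
    then show "finite A" using fin finite_subset by blast
  qed
  also have "\<dots> = (\<Sum>C\<in>{C\<in>?O. card C = 1}. card C) + (\<Sum>C\<in>{C\<in>?O. card C \<noteq> 1}. card C)"
    using finO by (subst sum.union_disjoint[symmetric]) (auto intro!: sum.cong)
  also have "(\<Sum>C\<in>{C\<in>?O. card C = 1}. card C) = card {C\<in>?O. card C = 1}"
    by simp
  finally have sum: "p ^ k = card {C\<in>?O. card C = 1} + (\<Sum>C\<in>{C\<in>?O. card C \<noteq> 1}. card C)"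
    using ord by (simp add: order_def)
  \<comment> \<open>Orbit sizes divide the group order \<open>p ^ k\<close>, so each size other than
    1 is a multiple of \<open>p\<close>.\<close>
  have "p dvd (\<Sum>C\<in>{C\<in>?O. card C \<noteq> 1}. card C)"
  proof (rule dvd_sum)
    fix C assume C: "C \<in> {C\<in>?O. card C \<noteq> 1}"
    then obtain x where "x \<in> carrier G" "C = orbit G \<phi> x" by (auto simp: orbits_def)
    then have "card C dvd p ^ k"
      using act.orbit_stabilizer_theorem ord by (metis dvd_triv_left)
    then obtain i where "card C = p ^ i" using p divides_primepow_nat by blast
    then show "p dvd card C" using C by (cases i) auto
  qed
  moreover have "p dvd p ^ k" using k by simp
  then have "p dvd card {C\<in>?O. card C = 1} + (\<Sum>C\<in>{C\<in>?O. card C \<noteq> 1}. card C)"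
    by (simp only: sum)
  ultimately have dvd: "p dvd card {C\<in>?O. card C = 1}"
    by (simp only: dvd_add_left_iff)
  have central: "z \<in> Z" if "z \<in> carrier G" "card (orbit G \<phi> z) = 1" for z
  proof -
    obtain w where w: "orbit G \<phi> z = {w}" using \<open>card (orbit G \<phi> z) = 1\<close> card_1_singletonE by blast
    have "g \<otimes> z \<otimes> inv g = w" if "g \<in> carrier G" for g
    proof -
      have "\<phi> g z \<in> orbit G \<phi> z" using that by (auto simp: orbit_def)
      then show ?thesis using w \<open>z \<in> carrier G\<close> by (simp add: \<phi>_def)
    qed
    moreover from this[of \<one>] have "w = z" using \<open>z \<in> carrier G\<close> by simp
    ultimately have conj: "g \<otimes> z \<otimes> inv g = z" if "g \<in> carrier G" for g
      using that by simp
    have "z \<otimes> g = g \<otimes> z" if "g \<in> carrier G" for g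
    proof -
      have "z \<otimes> g = g \<otimes> z \<otimes> inv g \<otimes> g" by (simp only: conj that)
      then show ?thesis using that \<open>z \<in> carrier G\<close> by (simp add: m_assoc)
    qed
    then show ?thesis using \<open>z \<in> carrier G\<close> by (simp add: Z_def)
  qed
  have one: "\<one> \<in> Z" by (simp add: Z_def)
  \<comment> \<open>The orbit of the identity makes the count of one-point orbits positive, hence at
    least \<open>p\<close>, hence more than one.\<close>
  have "{\<one>} \<in> {C\<in>?O. card C = 1}"
  proof -
    have "orbit G \<phi> \<one> = {\<one>}" by (auto simp: orbit_def \<phi>_def intro!: exI[of _ \<one>])
    then show ?thesis by (auto simp: orbits_def)
  qed
  then have "card {C\<in>?O. card C = 1} > 0"
    using finO by (auto simp: card_gt_0_iff simp del: One_nat_def)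
  then have "p \<le> card {C\<in>?O. card C = 1}" using dvd by (simp add: dvd_imp_le)
  then have "card {C\<in>?O. card C = 1} > 1" using prime_gt_1_nat[OF p] by linarith
  then have "\<not> {C\<in>?O. card C = 1} \<subseteq> {{\<one>}}"
    using card_mono[of "{{\<one>}}" "{C\<in>?O. card C = 1}"] by force
  then obtain C where C: "C \<in> ?O" "card C = 1" "C \<noteq> {\<one>}"
    by blast
  then obtain z where z: "z \<in> carrier G" "C = orbit G \<phi> z" by (auto simp: orbits_def)
  then have zZ: "z \<in> Z" using central C by simp
  have "z \<in> C" using z act.orbit_refl by auto
  then have "z \<noteq> \<one>" using C(2,3) by (auto simp: card_1_singleton_iff)
  have fact: "z [^] (p ^ k) = \<one>" using pow_order_eq_1[OF z(1)] ord by simp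
  \<comment> \<open>Taking \<open>p\<close>-th powers repeatedly leads from \<open>z\<close> to
    \<open>\<one>\<close> after \<open>b\<close> rounds; the value one round earlier is the element
    of order \<open>p\<close>.\<close>
  define b where "b = (LEAST b. z [^] (p ^ b) = \<one>)"
  have b: "z [^] (p ^ b) = \<one>" unfolding b_def using fact by (rule LeastI)
  have "b \<noteq> 0"
  proof
    assume "b = 0"
    then show False using b z(1) \<open>z \<noteq> \<one>\<close> by simp
  qed
  then obtain a where a: "b = Suc a" using not0_implies_Suc by blast
  have ne: "z [^] (p ^ a) \<noteq> \<one>"
    using not_less_Least[of a "\<lambda>b. z [^] (p ^ b) = \<one>"] a unfolding b_def by auto
  have "z [^] m \<in> Z" for m :: nat
  proof (induction m)
    case (Suc m)
    have "z [^] m \<otimes> z \<otimes> u = u \<otimes> (z [^] m \<otimes> z)" if u: "u \<in> carrier G" for u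
    proof -
      have "z [^] m \<otimes> z \<otimes> u = z [^] m \<otimes> (u \<otimes> z)"
        using zZ u z(1) by (simp add: Z_def m_assoc)
      also have "\<dots> = u \<otimes> z [^] m \<otimes> z"
        using Suc u z(1) by (simp add: Z_def flip: m_assoc)
      finally show ?thesis using u z(1) by (simp add: m_assoc)
    qed
    then show ?case using z(1) by (simp add: Z_def)
  qed (use one in simp)
  then have "z [^] (p ^ a) \<in> Z" .
  moreover have "(z [^] (p ^ a)) [^] p = \<one>"
    using b a z(1) by (simp add: nat_pow_pow mult.commute)
  ultimately show thesis
    using that[of "z [^] (p ^ a)"] ne by (simp add: Z_def)
qed

section \<open>Powers of products modulo a normal subgroup\<close>

lemma (in normal) coset_collect_mult_pow:
  assumes "x \<in> carrier G" "z \<in> carrier G" "c \<in> carrier G"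
    and "H #> (z \<otimes> x) = H #> (x \<otimes> z \<otimes> c)"
    and "H #> (c \<otimes> x) = H #> (x \<otimes> c)" "H #> (c \<otimes> z) = H #> (z \<otimes> c)"
  shows "H #> ((x \<otimes> z) [^] (n::nat)) = H #> (x [^] n \<otimes> z [^] n \<otimes> c [^] (n * (n - 1) div 2))"
proof -
  interpret Q: group "G Mod H" by (rule factorgroup_is_group)
  have c: "H #> a \<in> carrier (G Mod H)" if "a \<in> carrier G" for a
    using that by (auto simp: carrier_FactGroup)
  show ?thesis
    using Q.collect_mult_pow[of "H #> x" "H #> z" "H #> c" n] assms
    by (simp add: c rcos_sum FactGroup_pow)
qed

lemma (in normal) coset_pow_mult_distrib:
  assumes "x \<in> carrier G" "z \<in> carrier G" "H #> (x \<otimes> z) = H #> (z \<otimes> x)"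
  shows "H #> ((x \<otimes> z) [^] (n::nat)) = H #> (x [^] n \<otimes> z [^] n)"
proof -
  interpret Q: group "G Mod H" by (rule factorgroup_is_group)
  have c: "H #> a \<in> carrier (G Mod H)" if "a \<in> carrier G" for a
    using that by (auto simp: carrier_FactGroup)
  have "(H #> x) <#> (H #> z) = (H #> z) <#> (H #> x)"
    using assms by (simp add: rcos_sum)
  then have "((H #> x) <#> (H #> z)) [^]\<^bsub>G Mod H\<^esub> n =
      (H #> x) [^]\<^bsub>G Mod H\<^esub> n <#> (H #> z) [^]\<^bsub>G Mod H\<^esub> n"
    using Q.pow_mult_distrib[of "H #> x" "H #> z" n] assms(1,2) by (simp add: c)
  then show ?thesis
    using assms(1,2) by (simp add: rcos_sum FactGroup_pow)
qed

lemma (in subgroup) coset_eq_subset: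
  assumes "group G" "subgroup K G" "H \<subseteq> K" "a \<in> carrier G" "b \<in> carrier G" "H #> a = H #> b"
  shows "K #> a = K #> b"
  using coset_eq_iff[OF assms(1,4,5)] subgroup.coset_eq_iff[OF assms(2,1,4,5)] assms(3,6) by auto

lemma (in normal) coset_pow_mod:
  assumes x: "x \<in> carrier G" and q: "x [^] (q::nat) \<in> H"
  shows "H #> x [^] e = H #> x [^] (e mod q)"
proof -
  have "(x [^] q) [^] i \<in> H" for i :: nat
    using q by (induction i) (auto simp: m_closed)
  then have "H #> ((x [^] q) [^] (e div q)) = H #> \<one>"
    using x by (subst coset_eq_iff[OF is_group]) auto
  then have "H #> ((x [^] q) [^] (e div q) \<otimes> x [^] (e mod q)) = H #> (\<one> \<otimes> x [^] (e mod q))"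
    using x by (intro coset_mult_cong) auto
  then show ?thesis using x by (simp add: nat_pow_pow nat_pow_mult)
qed

section \<open>Coordinates along a p-filtration\<close>

text \<open>Only what the lower p-series of every topological group satisfies: each layer is central
  in the quotient by the next term and is killed by \<open>p\<close>. Uniformity is kept apart,
  because the lemmas proved here are the means by which its consequences are later
  established.\<close>

locale p_filtration = group G for G (structure) +
  fixes p :: nat and W :: "nat \<Rightarrow> 'a set"
  assumes prime_p: "prime p"
    and W_normal: "W n \<lhd> G"
    and W_0: "W 0 = carrier G"
    and W_Suc_subset: "W (Suc n) \<subseteq> W n"
    and W_comm: "x \<in> W n \<Longrightarrow> u \<in> carrier G \<Longrightarrow> x \<otimes> u \<otimes> inv x \<otimes> inv u \<in> W (Suc n)"
    and W_pow: "x \<in> W n \<Longrightarrow> x [^] p \<in> W (Suc n)"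
begin

lemma W_subgroup: "subgroup (W n) G"
  using W_normal normal_imp_subgroup by blast

lemma W_carrier: "x \<in> W n \<Longrightarrow> x \<in> carrier G"
  using subgroup.mem_carrier[OF W_subgroup] .

lemma W_subset: "m \<le> n \<Longrightarrow> W n \<subseteq> W m"
  using W_Suc_subset by (rule lift_Suc_antimono_le)

lemma W_coset_eq_iff:
  "a \<in> carrier G \<Longrightarrow> b \<in> carrier G \<Longrightarrow> W n #> a = W n #> b \<longleftrightarrow> a \<otimes> inv b \<in> W n"
  using subgroup.coset_eq_iff[OF W_subgroup group_axioms] .

lemma W_coset_one: "a \<in> W n \<Longrightarrow> W n #> a = W n #> \<one>"
  using W_carrier W_coset_eq_iff by simp

lemma W_central:
  assumes "z \<in> W n" "u \<in> carrier G"
  shows "W (Suc n) #> (z \<otimes> u) = W (Suc n) #> (u \<otimes> z)"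
  using normal.coset_comm_iff[OF W_normal W_carrier[OF assms(1)] assms(2)] W_comm assms by blast

text \<open>One layer down, \<open>z\<close> is still central, so no commutator appears.\<close>

lemma W_pow_mult_Suc:
  assumes "x \<in> carrier G" "z \<in> W n"
  shows "W (Suc n) #> ((x \<otimes> z) [^] (m::nat)) = W (Suc n) #> (x [^] m \<otimes> z [^] m)"
  using normal.coset_pow_mult_distrib[OF W_normal] assms W_central W_carrier by metis

text \<open>Two layers down \<open>z\<close> is no longer central, and collection leaves the
  \<open>p * (p - 1) div 2\<close>-th power of a commutator in \<open>W (Suc n)\<close>. For odd
  \<open>p\<close> this is a power of a \<open>p\<close>-th power and sinks into
  \<open>W (Suc (Suc n))\<close>. For \<open>p = 2\<close> it is the commutator itself, whence the
  extra hypothesis.\<close>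

lemma W_pow_mult:
  assumes x: "x \<in> carrier G" and z: "z \<in> W n"
    and two: "p = 2 \<Longrightarrow> x \<otimes> z \<otimes> inv x \<otimes> inv z \<in> W (Suc (Suc n))"
  shows "W (Suc (Suc n)) #> ((x \<otimes> z) [^] p) = W (Suc (Suc n)) #> (x [^] p \<otimes> z [^] p)"
proof (cases "p = 2")
  case True
  interpret normal "W (Suc (Suc n))" G by (rule W_normal)
  show ?thesis
    using coset_pow_mult_distrib[OF x] coset_comm_iff[OF x] W_carrier[OF z] two[OF True] by blast
next
  case False
  interpret N: normal "W (Suc (Suc n))" G by (rule W_normal)
  note zc = W_carrier[OF z]
  define c where "c = inv z \<otimes> inv x \<otimes> z \<otimes> x"
  have cc: "c \<in> carrier G" using x zc by (simp add: c_def)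
  have "inv z \<in> W n" using z by (rule subgroup.m_inv_closed[OF W_subgroup])
  then have c: "c \<in> W (Suc n)"
    using W_comm[of "inv z" n "inv x"] x zc by (simp add: c_def)
  have "z \<otimes> x = x \<otimes> z \<otimes> c"
    using x zc by (simp add: c_def m_assoc mult_inv_cancel)
  then have "W (Suc (Suc n)) #> ((x \<otimes> z) [^] p) =
      W (Suc (Suc n)) #> (x [^] p \<otimes> z [^] p \<otimes> c [^] (p * (p - 1) div 2))"
    using N.coset_collect_mult_pow[OF x zc cc] W_central[OF c x] W_central[OF c zc] by simp
  also have "\<dots> = W (Suc (Suc n)) #> (x [^] p \<otimes> z [^] p \<otimes> \<one>)"
  proof (rule N.coset_mult_cong)
    \<comment> \<open>Oddness lets the 2 divide \<open>p - 1\<close>, so that the factor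
      \<open>p\<close> survives in the exponent.\<close>
    have "odd p" using prime_p False by (simp add: prime_odd_nat prime_ge_2_nat order.not_eq_order_implies_strict)
    then obtain q where q: "p - 1 = 2 * q"
      by (metis odd_two_times_div_two_nat)
    have "p * (p - 1) div 2 = p * q"
      unfolding q by simp
    then have "c [^] (p * (p - 1) div 2) = (c [^] p) [^] q"
      using cc by (simp add: nat_pow_pow)
    moreover have "(c [^] p) [^] q \<in> W (Suc (Suc n))"
      using W_pow[OF c] by (induction q) (auto simp: N.m_closed)
    ultimately have "c [^] (p * (p - 1) div 2) \<in> W (Suc (Suc n))" by simp
    then show "W (Suc (Suc n)) #> c [^] (p * (p - 1) div 2) = W (Suc (Suc n)) #> \<one>"
      by (rule W_coset_one)
  qed (use x zc cc in auto)
  finally show ?thesis using x zc by simp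
qed

text \<open>Well-definedness of the power map from one layer to the next: changing an element by
  \<open>w\<close> in \<open>W (Suc n)\<close> changes its \<open>p\<close>-th power by
  \<open>w [^] p\<close>, which lies in \<open>W (Suc (Suc n))\<close>.\<close>

lemma W_pow_cong:
  assumes x: "x \<in> W n" and y: "y \<in> W n" and eq: "W (Suc n) #> x = W (Suc n) #> y"
  shows "W (Suc (Suc n)) #> (x [^] p) = W (Suc (Suc n)) #> (y [^] p)"
proof -
  interpret N: normal "W (Suc (Suc n))" G by (rule W_normal)
  note c = W_carrier[OF x] W_carrier[OF y]
  define w where "w = inv y \<otimes> x"
  have "x \<otimes> inv y \<in> W (Suc n)" using eq W_coset_eq_iff c by simp
  then have "inv y \<otimes> (x \<otimes> inv y) \<otimes> y \<in> W (Suc n)"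
    using c by (intro normal.inv_op_closed1[OF W_normal]) auto
  then have w: "w \<in> W (Suc n)" using c by (simp add: w_def m_assoc)
  have "x = y \<otimes> w" using c by (simp add: w_def mult_inv_cancel)
  then have "W (Suc (Suc n)) #> (x [^] p) = W (Suc (Suc n)) #> (y [^] p \<otimes> w [^] p)"
    using W_pow_mult_Suc[OF c(2) w] by simp
  also have "\<dots> = W (Suc (Suc n)) #> (y [^] p \<otimes> \<one>)"
    using W_coset_one[OF W_pow[OF w]] c W_carrier[OF w] by (intro N.coset_mult_cong) auto
  finally show ?thesis using c by simp
qed

end

text \<open>The group is noncommutative, so the factors come in a fixed order. The recursion is that
  of \<open>procyclic_product\<close>, whose members are thereby values of
  \<open>ordprod\<close>.\<close>

definition ordprod :: "('a, 'b) monoid_scheme \<Rightarrow> (nat \<Rightarrow> 'a) \<Rightarrow> nat list \<Rightarrow> 'a" where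
  "ordprod G f ks = foldr (\<lambda>k s. f k \<otimes>\<^bsub>G\<^esub> s) ks \<one>\<^bsub>G\<^esub>"

lemma ordprod_simps [simp]:
  "ordprod G f [] = \<one>\<^bsub>G\<^esub>" "ordprod G f (k # ks) = f k \<otimes>\<^bsub>G\<^esub> ordprod G f ks"
  by (simp_all add: ordprod_def)

lemma (in monoid) ordprod_closed:
  "(\<And>k. k \<in> set ks \<Longrightarrow> f k \<in> carrier G) \<Longrightarrow> ordprod G f ks \<in> carrier G"
  by (induction ks) auto

lemma (in subgroup) ordprod_mem:
  "(\<And>k. k \<in> set ks \<Longrightarrow> f k \<in> H) \<Longrightarrow> ordprod G f ks \<in> H"
  by (induction ks) auto

lemma ordprod_cong:
  "(\<And>k. k \<in> set ks \<Longrightarrow> f k = g k) \<Longrightarrow> ordprod G f ks = ordprod G g ks"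
  by (induction ks) auto

lemma (in normal) coset_ordprod_cong:
  assumes "\<And>k. k \<in> set ks \<Longrightarrow> f k \<in> carrier G" "\<And>k. k \<in> set ks \<Longrightarrow> g k \<in> carrier G"
    and "\<And>k. k \<in> set ks \<Longrightarrow> H #> f k = H #> g k"
  shows "H #> ordprod G f ks = H #> ordprod G g ks"
  using assms
proof (induction ks)
  case (Cons k ks)
  then show ?case
    by (simp, intro coset_mult_cong ordprod_closed) auto
qed simp

context p_filtration
begin

text \<open>All the \<open>g k\<close> are central modulo \<open>W (Suc n)\<close>, so they can be
  moved past the remaining \<open>f k\<close> and gathered on the right.\<close>

lemma W_ordprod_mult:
  assumes "\<And>k. k \<in> set ks \<Longrightarrow> f k \<in> carrier G" "\<And>k. k \<in> set ks \<Longrightarrow> g k \<in> W n"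
  shows "W (Suc n) #> ordprod G (\<lambda>k. f k \<otimes> g k) ks =
         W (Suc n) #> (ordprod G f ks \<otimes> ordprod G g ks)"
  using assms
proof (induction ks)
  case (Cons k ks)
  interpret N: normal "W (Suc n)" G by (rule W_normal)
  let ?F = "ordprod G f ks" and ?P = "ordprod G g ks"
  let ?Q = "ordprod G (\<lambda>k. f k \<otimes> g k) ks"
  have fk: "f k \<in> carrier G" and gk: "g k \<in> W n" and gkc: "g k \<in> carrier G"
    using Cons.prems W_carrier by auto
  have F: "?F \<in> carrier G" using Cons.prems by (intro ordprod_closed) auto
  have P: "?P \<in> carrier G"
    using subgroup.mem_carrier[OF W_subgroup] subgroup.ordprod_mem[OF W_subgroup] Cons.prems(2)
    by (metis list.set_intros(2))
  have "g j \<in> carrier G" if "j \<in> set ks" for j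
    using Cons.prems(2)[of j] W_carrier that by simp
  then have Q: "?Q \<in> carrier G" using Cons.prems by (intro ordprod_closed) auto
  have IH: "W (Suc n) #> ?Q = W (Suc n) #> (?F \<otimes> ?P)"
    using Cons by simp
  have "W (Suc n) #> (f k \<otimes> g k \<otimes> ?Q) = W (Suc n) #> (f k \<otimes> g k \<otimes> (?F \<otimes> ?P))"
    using fk gkc F P Q IH by (intro N.coset_mult_cong) auto
  also have "\<dots> = W (Suc n) #> (f k \<otimes> (g k \<otimes> ?F) \<otimes> ?P)"
    using fk gkc F P by (simp add: m_assoc)
  also have "\<dots> = W (Suc n) #> (f k \<otimes> (?F \<otimes> g k) \<otimes> ?P)"
    using fk gkc F P N.coset_mult_cong[OF fk fk _ _ refl W_central[OF gk F]]
    by (intro N.coset_mult_cong[OF _ _ _ _ _ refl]) auto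
  also have "\<dots> = W (Suc n) #> (f k \<otimes> ?F \<otimes> (g k \<otimes> ?P))"
    using fk gkc F P by (simp add: m_assoc)
  finally show ?case by simp
qed simp

end

text \<open>\<open>W_two\<close> makes the \<open>p\<close>-th power map a homomorphism between
  consecutive layers also for \<open>p = 2\<close>; the other two assumptions say that it is onto
  and has trivial kernel.\<close>

locale uniform_filtration = p_filtration +
  assumes W_two: "p = 2 \<Longrightarrow> x \<in> W n \<Longrightarrow> u \<in> carrier G \<Longrightarrow>
        x \<otimes> u \<otimes> inv x \<otimes> inv u \<in> W (Suc (Suc n))"
    and W_pow_onto: "z \<in> W (Suc n) \<Longrightarrow> \<exists>y\<in>W n. W (Suc (Suc n)) #> y [^] p = W (Suc (Suc n)) #> z"
    and W_pow_inj: "x \<in> W n \<Longrightarrow> x [^] p \<in> W (Suc (Suc n)) \<Longrightarrow> x \<in> W (Suc n)"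
begin

lemma W_pow_hom:
  assumes "x \<in> W n" "z \<in> W n"
  shows "W (Suc (Suc n)) #> ((x \<otimes> z) [^] p) = W (Suc (Suc n)) #> (x [^] p \<otimes> z [^] p)"
  using W_pow_mult W_two assms W_carrier by blast

lemma W_pow_cong_iff:
  assumes x: "x \<in> W n" and y: "y \<in> W n"
  shows "W (Suc (Suc n)) #> (x [^] p) = W (Suc (Suc n)) #> (y [^] p) \<longleftrightarrow>
         W (Suc n) #> x = W (Suc n) #> y"
proof
  assume eq: "W (Suc (Suc n)) #> (x [^] p) = W (Suc (Suc n)) #> (y [^] p)"
  note c = W_carrier[OF x] W_carrier[OF y]
  have iy: "inv y \<in> W n" using y by (rule subgroup.m_inv_closed[OF W_subgroup])
  have "W (Suc (Suc n)) #> ((x \<otimes> inv y) [^] p) = W (Suc (Suc n)) #> (x [^] p \<otimes> inv (y [^] p))"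
    using W_pow_hom[OF x iy] c by (simp add: nat_pow_inv)
  also have "\<dots> = W (Suc (Suc n)) #> \<one>"
    using eq W_coset_eq_iff c by (intro W_coset_one) simp
  finally have "(x \<otimes> inv y) [^] p \<in> W (Suc (Suc n))"
    using W_coset_eq_iff[of "(x \<otimes> inv y) [^] p" \<one>] c by simp
  moreover have "x \<otimes> inv y \<in> W n" using x iy by (rule subgroup.m_closed[OF W_subgroup])
  ultimately show "W (Suc n) #> x = W (Suc n) #> y"
    using W_pow_inj W_coset_eq_iff c by blast
next
  assume "W (Suc n) #> x = W (Suc n) #> y"
  then show "W (Suc (Suc n)) #> (x [^] p) = W (Suc (Suc n)) #> (y [^] p)"
    using W_pow_cong x y by blast
qed

lemma W_ordprod_pow:
  assumes "\<And>k. k \<in> set ks \<Longrightarrow> f k \<in> W n"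
  shows "W (Suc (Suc n)) #> (ordprod G f ks [^] p) =
         W (Suc (Suc n)) #> ordprod G (\<lambda>k. f k [^] p) ks"
  using assms
proof (induction ks)
  case (Cons k ks)
  interpret N: normal "W (Suc (Suc n))" G by (rule W_normal)
  have P: "ordprod G f ks \<in> W n"
    using Cons.prems by (intro subgroup.ordprod_mem[OF W_subgroup]) auto
  have k: "f k \<in> W n" using Cons.prems by simp
  have "W (Suc (Suc n)) #> (ordprod G f (k # ks) [^] p) =
      W (Suc (Suc n)) #> (f k [^] p \<otimes> ordprod G f ks [^] p)"
    using W_pow_hom[OF k P] by simp
  also have "\<dots> = W (Suc (Suc n)) #> (f k [^] p \<otimes> ordprod G (\<lambda>k. f k [^] p) ks)"
    using W_carrier[OF P] W_carrier[OF k] Cons W_carrier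
    by (intro N.coset_mult_cong ordprod_closed nat_pow_closed) auto
  finally show ?case by simp
qed simp

end

text \<open>The two base assumptions say that the \<open>x k\<close> give a basis of the first
  layer, a vector space over the field with \<open>p\<close> elements, written with exponents below
  \<open>p\<close>. The power map carries this basis to every deeper layer.\<close>

locale uniform_coordinates = uniform_filtration +
  fixes x :: "nat \<Rightarrow> 'a" and ks :: "nat list"
  assumes distinct_ks: "distinct ks"
    and x_carrier: "k \<in> set ks \<Longrightarrow> x k \<in> carrier G"
    and base_span: "u \<in> carrier G \<Longrightarrow> \<exists>f. (\<forall>k\<in>set ks. f k < p) \<and>
          W (Suc 0) #> u = W (Suc 0) #> ordprod G (\<lambda>k. x k [^] (f k :: nat)) ks"
    and base_indep: "(\<And>k. k \<in> set ks \<Longrightarrow> f k < p) \<Longrightarrow> (\<And>k. k \<in> set ks \<Longrightarrow> g k < p) \<Longrightarrow>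
          W (Suc 0) #> ordprod G (\<lambda>k. x k [^] (f k :: nat)) ks =
          W (Suc 0) #> ordprod G (\<lambda>k. x k [^] (g k :: nat)) ks \<Longrightarrow> k \<in> set ks \<Longrightarrow> f k = g k"
begin

text \<open>Coordinates of the second kind. A natural exponent below \<open>p ^ n\<close> plays the
  part of a p-adic exponent truncated after \<open>n\<close> digits.\<close>

definition coord where "coord e = ordprod G (\<lambda>k. x k [^] (e k :: nat)) ks"

lemma coord_carrier: "coord e \<in> carrier G"
  unfolding coord_def using x_carrier by (intro ordprod_closed) auto

lemma x_pow_mem: "k \<in> set ks \<Longrightarrow> x k [^] (p ^ n * m) \<in> W n"
proof (induction n)
  case 0
  then show ?case using x_carrier by (simp add: W_0)
next
  case (Suc n)
  then show ?case using W_pow[of "x k [^] (p ^ n * m)" n] x_carrier[of k]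
    by (simp add: nat_pow_pow ac_simps)
qed

lemma coord_mem: "coord (\<lambda>k. p ^ n * f k) \<in> W n"
  unfolding coord_def using x_pow_mem by (intro subgroup.ordprod_mem[OF W_subgroup])

lemma coord_pow:
  "W (Suc (Suc n)) #> (coord (\<lambda>k. p ^ n * f k) [^] p) = W (Suc (Suc n)) #> coord (\<lambda>k. p ^ Suc n * f k)"
proof -
  have "ordprod G (\<lambda>k. (x k [^] (p ^ n * f k)) [^] p) ks = coord (\<lambda>k. p ^ Suc n * f k)"
    unfolding coord_def using x_carrier by (intro ordprod_cong) (simp add: nat_pow_pow ac_simps)
  then show ?thesis
    using W_ordprod_pow[of ks "\<lambda>k. x k [^] (p ^ n * f k)" n] x_pow_mem
    unfolding coord_def[of "\<lambda>k. p ^ n * f k"] by simp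
qed

text \<open>Adding exponents does not correspond to multiplication in general; it does here because
  the second summand contributes factors in \<open>W n\<close>, which are central modulo
  \<open>W (Suc n)\<close>.\<close>

lemma coord_add:
  "W (Suc n) #> coord (\<lambda>k. e k + p ^ n * f k) = W (Suc n) #> (coord e \<otimes> coord (\<lambda>k. p ^ n * f k))"
proof -
  have "coord (\<lambda>k. e k + p ^ n * f k) = ordprod G (\<lambda>k. x k [^] e k \<otimes> x k [^] (p ^ n * f k)) ks"
    unfolding coord_def using x_carrier by (intro ordprod_cong) (simp add: nat_pow_mult)
  then show ?thesis
    using W_ordprod_mult[of ks "\<lambda>k. x k [^] e k" "\<lambda>k. x k [^] (p ^ n * f k)" n] x_pow_mem x_carrier
    by (simp add: coord_def)
qed

text \<open>Take a \<open>p\<close>-th root modulo the layer below, expand it by induction, and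
  raise the expansion to the \<open>p\<close>-th power again.\<close>

lemma layer_span:
  "y \<in> W n \<Longrightarrow> \<exists>f. (\<forall>k\<in>set ks. f k < p) \<and> W (Suc n) #> y = W (Suc n) #> coord (\<lambda>k. p ^ n * f k)"
proof (induction n arbitrary: y)
  case 0
  then show ?case using base_span W_0 by (simp add: coord_def)
next
  case (Suc n)
  obtain z where z: "z \<in> W n" "W (Suc (Suc n)) #> z [^] p = W (Suc (Suc n)) #> y"
    using W_pow_onto Suc.prems by blast
  obtain f where f: "\<forall>k\<in>set ks. f k < p" "W (Suc n) #> z = W (Suc n) #> coord (\<lambda>k. p ^ n * f k)"
    using Suc.IH z by blast
  have "W (Suc (Suc n)) #> z [^] p = W (Suc (Suc n)) #> (coord (\<lambda>k. p ^ n * f k) [^] p)"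
    using W_pow_cong z(1) coord_mem f(2) by blast
  then show ?case using f z(2) coord_pow by metis
qed

lemma layer_indep:
  assumes "\<And>k. k \<in> set ks \<Longrightarrow> f k < p" "\<And>k. k \<in> set ks \<Longrightarrow> g k < p"
    and "W (Suc n) #> coord (\<lambda>k. p ^ n * f k) = W (Suc n) #> coord (\<lambda>k. p ^ n * g k)" "k \<in> set ks"
  shows "f k = g k"
  using assms(3)
proof (induction n)
  case 0
  then show ?case using base_indep[of f g k] assms by (simp add: coord_def)
next
  case (Suc n)
  then show ?case using W_pow_cong_iff[OF coord_mem coord_mem] coord_pow by metis
qed

text \<open>Expansion in base \<open>p\<close>: the digits found so far give \<open>u\<close> up to
  an error in \<open>W n\<close>, and \<open>layer_span\<close> applied to that error supplies the
  next digit of every exponent.\<close>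

lemma span: "u \<in> carrier G \<Longrightarrow> \<exists>e. (\<forall>k\<in>set ks. e k < p ^ n) \<and> W n #> u = W n #> coord e"
proof (induction n)
  case 0
  have "W 0 #> u = W 0 #> coord (\<lambda>_. 0)"
    using W_coset_eq_iff[OF 0 coord_carrier, of 0] 0 coord_carrier by (simp add: W_0)
  then show ?case by (intro exI[of _ "\<lambda>_. 0"]) simp
next
  case (Suc n)
  interpret N: normal "W (Suc n)" G by (rule W_normal)
  obtain e where e: "\<forall>k\<in>set ks. e k < p ^ n" "W n #> u = W n #> coord e"
    using Suc by blast
  \<comment> \<open>The error is placed on the right of \<open>coord e\<close>, which is where
    \<open>coord_add\<close> expects the new digit.\<close>
  define y where "y = inv (coord e) \<otimes> u"
  have "u \<otimes> inv (coord e) \<in> W n" using e Suc.prems coord_carrier W_coset_eq_iff by simp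
  then have "inv (coord e) \<otimes> (u \<otimes> inv (coord e)) \<otimes> coord e \<in> W n"
    using coord_carrier by (intro normal.inv_op_closed1[OF W_normal]) auto
  then have y: "y \<in> W n" using Suc.prems coord_carrier by (simp add: y_def m_assoc)
  then obtain f where f: "\<forall>k\<in>set ks. f k < p"
      "W (Suc n) #> y = W (Suc n) #> coord (\<lambda>k. p ^ n * f k)"
    using layer_span by blast
  have "u = coord e \<otimes> y" using Suc.prems coord_carrier by (simp add: y_def mult_inv_cancel)
  then have "W (Suc n) #> u = W (Suc n) #> (coord e \<otimes> coord (\<lambda>k. p ^ n * f k))"
    using N.coset_mult_cong[OF coord_carrier coord_carrier W_carrier[OF y] coord_carrier refl f(2)]
    by simp
  then have "W (Suc n) #> u = W (Suc n) #> coord (\<lambda>k. e k + p ^ n * f k)"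
    by (simp add: coord_add)
  moreover have "e k + p ^ n * f k < p ^ Suc n" if "k \<in> set ks" for k
  proof -
    have "e k + p ^ n * f k < p ^ n + p ^ n * f k" using e that by simp
    also have "\<dots> = p ^ n * Suc (f k)" by simp
    also have "\<dots> \<le> p ^ n * p" using f that by (intro mult_left_mono) (auto simp: Suc_le_eq)
    finally show ?thesis by (simp add: mult.commute)
  qed
  ultimately show ?case by (intro exI[of _ "\<lambda>k. e k + p ^ n * f k"]) blast
qed

lemma coord_indep:
  "(\<And>k. k \<in> set ks \<Longrightarrow> e k < p ^ n) \<Longrightarrow> (\<And>k. k \<in> set ks \<Longrightarrow> g k < p ^ n) \<Longrightarrow>
   W n #> coord e = W n #> coord g \<Longrightarrow> k \<in> set ks \<Longrightarrow> e k = g k"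
proof (induction n arbitrary: e g k)
  case 0
  then show ?case by (metis less_one power_0)
next
  case (Suc n)
  interpret N: normal "W (Suc n)" G by (rule W_normal)
  \<comment> \<open>The first \<open>n\<close> digits of each exponent, and the digit at place
    \<open>n\<close>. Modulo \<open>W n\<close> only the former are visible, so the induction
    hypothesis identifies them; after they are cancelled, \<open>layer_indep\<close> identifies the
    latter.\<close>
  let ?lo = "\<lambda>e k. e k mod p ^ n" and ?hi = "\<lambda>e k. e k div p ^ n"
  have split: "W (Suc n) #> coord e = W (Suc n) #> (coord (?lo e) \<otimes> coord (\<lambda>k. p ^ n * ?hi e k))" for e
    using coord_add[of n "?lo e" "?hi e"] by simp
  have lo: "W n #> coord e = W n #> coord (?lo e)" for e
  proof -
    have "W n #> coord e = W n #> (coord (?lo e) \<otimes> coord (\<lambda>k. p ^ n * ?hi e k))"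
      using subgroup.coset_eq_subset[OF W_subgroup group_axioms W_subgroup W_Suc_subset _ _ split] coord_carrier
      by simp
    also have "\<dots> = W n #> (coord (?lo e) \<otimes> \<one>)"
      using coord_carrier W_coset_one[OF coord_mem] by (intro normal.coset_mult_cong[OF W_normal]) auto
    finally show ?thesis using coord_carrier by simp
  qed
  have p0: "p ^ n > 0" using prime_p by (simp add: prime_gt_0_nat)
  have "W n #> coord e = W n #> coord g"
    using subgroup.coset_eq_subset[OF W_subgroup group_axioms W_subgroup W_Suc_subset _ _ Suc.prems(3)] coord_carrier
    by simp
  then have lo_eq: "?lo e k = ?lo g k" if "k \<in> set ks" for k
    using Suc.IH[of "?lo e" "?lo g" k] lo p0 that by simp
  then have mlo: "coord (?lo e) = coord (?lo g)"
    unfolding coord_def by (intro ordprod_cong) simp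
  have hi_lt: "?hi e k < p" if "e k < p ^ Suc n" for e :: "nat \<Rightarrow> nat" and k
    using that by (simp add: less_mult_imp_div_less)
  have m: "W (Suc n) #> (coord (?lo g) \<otimes> coord (\<lambda>k. p ^ n * ?hi e k)) =
      W (Suc n) #> (coord (?lo g) \<otimes> coord (\<lambda>k. p ^ n * ?hi g k))"
    using Suc.prems(3) split mlo by metis
  have "W (Suc n) #> (inv (coord (?lo g)) \<otimes> (coord (?lo g) \<otimes> coord (\<lambda>k. p ^ n * ?hi e k))) =
      W (Suc n) #> (inv (coord (?lo g)) \<otimes> (coord (?lo g) \<otimes> coord (\<lambda>k. p ^ n * ?hi g k)))"
    by (rule N.coset_mult_cong[OF _ _ _ _ refl m]) (simp_all add: coord_carrier)
  then have "W (Suc n) #> coord (\<lambda>k. p ^ n * ?hi e k) = W (Suc n) #> coord (\<lambda>k. p ^ n * ?hi g k)"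
    using coord_carrier by (simp add: mult_inv_cancel)
  then have "?hi e k = ?hi g k"
    using layer_indep[of "?hi e" "?hi g" n k] Suc.prems hi_lt by blast
  then show ?case using lo_eq[OF Suc.prems(4)] by (metis div_mult_mod_eq)
qed

lemma W_sub_carrier: "W n \<subseteq> carrier G"
  using W_carrier by blast

lemma card_rcosets_W: "card (rcosets (W n)) = p ^ (n * length ks)"
proof -
  let ?E = "PiE (set ks) (\<lambda>_. {..<p ^ n})"
  have "bij_betw (\<lambda>e. W n #> coord e) ?E (rcosets (W n))"
  proof (rule bij_betw_imageI)
    show "inj_on (\<lambda>e. W n #> coord e) ?E"
    proof (rule inj_onI)
      fix e g assume e: "e \<in> ?E" and g: "g \<in> ?E" and eq: "W n #> coord e = W n #> coord g"
      show "e = g"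
      proof (rule PiE_ext[OF e g])
        fix k assume "k \<in> set ks"
        then show "e k = g k" using coord_indep[of e n g k] e g eq by (auto simp: PiE_iff)
      qed
    qed
    show "(\<lambda>e. W n #> coord e) ` ?E = rcosets (W n)"
    proof
      show "(\<lambda>e. W n #> coord e) ` ?E \<subseteq> rcosets (W n)"
        using rcosetsI[OF W_sub_carrier coord_carrier] by blast
      show "rcosets (W n) \<subseteq> (\<lambda>e. W n #> coord e) ` ?E"
      proof
        fix C assume "C \<in> rcosets (W n)"
        then obtain u where u: "u \<in> carrier G" "C = W n #> u" by (auto simp: RCOSETS_def)
        then obtain e where e: "\<forall>k\<in>set ks. e k < p ^ n" "W n #> u = W n #> coord e"
          using span by blast
        have "coord (restrict e (set ks)) = coord e"
          unfolding coord_def by (intro ordprod_cong) simp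
        moreover have "restrict e (set ks) \<in> ?E" using e by auto
        ultimately show "C \<in> (\<lambda>e. W n #> coord e) ` ?E" using u e by (metis image_eqI)
      qed
    qed
  qed
  then have "card (rcosets (W n)) = card ?E" by (simp add: bij_betw_same_card)
  also have "\<dots> = p ^ (n * length ks)"
    using distinct_ks by (simp add: card_PiE prod_constant distinct_card power_mult)
  finally show ?thesis .
qed

text \<open>Every coset of \<open>N\<close> has a representative \<open>coord e\<close> because
  \<open>W n\<close> lies in \<open>N\<close>, and only the residue of \<open>e k\<close> modulo
  \<open>p ^ m k\<close> affects the coset.\<close>

lemma card_rcosets_upper:
  assumes N: "N \<lhd> G" and sub: "W n \<subseteq> N" and m: "\<And>k. k \<in> set ks \<Longrightarrow> x k [^] (p ^ m k) \<in> N"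
  shows "card (rcosets N) \<le> p ^ (\<Sum>k\<in>set ks. m k)"
proof -
  interpret N: normal N G by fact
  let ?E = "PiE (set ks) (\<lambda>k. {..<p ^ m k})"
  have p0: "p ^ i > 0" for i using prime_p by (simp add: prime_gt_0_nat)
  have "rcosets N \<subseteq> (\<lambda>e. N #> coord e) ` ?E"
  proof
    fix C assume "C \<in> rcosets N"
    then obtain u where u: "u \<in> carrier G" "C = N #> u" by (auto simp: RCOSETS_def)
    then obtain e where e: "W n #> u = W n #> coord e"
      using span by blast
    let ?f = "restrict (\<lambda>k. e k mod p ^ m k) (set ks)"
    have "N #> u = N #> coord e"
      using subgroup.coset_eq_subset[OF W_subgroup group_axioms N.subgroup_axioms sub u(1) coord_carrier e] .
    also have "\<dots> = N #> coord ?f"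
      unfolding coord_def
    proof (rule N.coset_ordprod_cong)
      fix k assume k: "k \<in> set ks"
      show "N #> x k [^] e k = N #> x k [^] ?f k"
        using N.coset_pow_mod[OF x_carrier[OF k] m[OF k], of "e k"] k by simp
    qed (use x_carrier in auto)
    finally have "C = N #> coord ?f" using u by simp
    moreover have "?f \<in> ?E" using p0 by auto
    ultimately show "C \<in> (\<lambda>e. N #> coord e) ` ?E" by blast
  qed
  then have "card (rcosets N) \<le> card ?E"
    by (intro surj_card_le finite_PiE) auto
  also have "\<dots> = p ^ (\<Sum>k\<in>set ks. m k)" by (simp add: card_PiE power_sum)
  finally show ?thesis .
qed

text \<open>\<open>H\<close> meets few cosets of \<open>W n\<close>, at most one for each choice of
  the multiples \<open>p ^ m k * g k\<close>. As the index of \<open>W n\<close> in \<open>G\<close>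
  is known exactly, few cosets inside \<open>H\<close> force many cosets of
  \<open>H\<close>.\<close>

lemma card_rcosets_lower:
  assumes H: "subgroup H G" and sub: "W n \<subseteq> H" and m: "\<And>k. k \<in> set ks \<Longrightarrow> m k \<le> n"
    and cov: "\<And>h. h \<in> H \<Longrightarrow> \<exists>g. (\<forall>k\<in>set ks. g k < p ^ (n - m k)) \<and>
        W n #> h = W n #> coord (\<lambda>k. p ^ m k * g k)"
  shows "p ^ (\<Sum>k\<in>set ks. m k) \<le> card (rcosets H)"
proof -
  let ?E = "PiE (set ks) (\<lambda>k. {..<p ^ (n - m k)})"
  have "rcosets\<^bsub>G\<lparr>carrier := H\<rparr>\<^esub> (W n) \<subseteq> (\<lambda>g. W n #> coord (\<lambda>k. p ^ m k * g k)) ` ?E"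
  proof
    fix C assume "C \<in> rcosets\<^bsub>G\<lparr>carrier := H\<rparr>\<^esub> (W n)"
    then obtain h where h: "h \<in> H" "C = W n #> h" by (auto simp: RCOSETS_def)
    then obtain g where g: "\<forall>k\<in>set ks. g k < p ^ (n - m k)"
        "W n #> h = W n #> coord (\<lambda>k. p ^ m k * g k)" using cov by blast
    have "coord (\<lambda>k. p ^ m k * restrict g (set ks) k) = coord (\<lambda>k. p ^ m k * g k)"
      unfolding coord_def by (intro ordprod_cong) simp
    then have "C = W n #> coord (\<lambda>k. p ^ m k * restrict g (set ks) k)"
      using h g(2) by simp
    moreover have "restrict g (set ks) \<in> ?E" using g by auto
    ultimately show "C \<in> (\<lambda>g. W n #> coord (\<lambda>k. p ^ m k * g k)) ` ?E"
      by (rule image_eqI)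
  qed
  then have "card (rcosets\<^bsub>G\<lparr>carrier := H\<rparr>\<^esub> (W n)) \<le> card ?E"
    by (intro surj_card_le finite_PiE) auto
  also have "\<dots> = p ^ (\<Sum>k\<in>set ks. n - m k)" by (simp add: card_PiE power_sum)
  finally have le: "card (rcosets\<^bsub>G\<lparr>carrier := H\<rparr>\<^esub> (W n)) \<le> p ^ (\<Sum>k\<in>set ks. n - m k)" .
  have "(\<Sum>k\<in>set ks. m k) + (\<Sum>k\<in>set ks. n - m k) = (\<Sum>k\<in>set ks. n)"
    using m by (simp flip: sum.distrib)
  then have exp: "(\<Sum>k\<in>set ks. m k) + (\<Sum>k\<in>set ks. n - m k) = n * length ks"
    using distinct_ks by (simp add: distinct_card)
  have "p ^ (\<Sum>k\<in>set ks. m k) * p ^ (\<Sum>k\<in>set ks. n - m k) = card (rcosets (W n))"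
    by (simp only: card_rcosets_W exp flip: power_add)
  also have "\<dots> = card (rcosets H) * card (rcosets\<^bsub>G\<lparr>carrier := H\<rparr>\<^esub> (W n))"
    by (rule card_rcosets_mult[OF W_subgroup H sub])
  also have "\<dots> \<le> card (rcosets H) * p ^ (\<Sum>k\<in>set ks. n - m k)"
    using le by (rule mult_left_mono) simp
  finally show ?thesis using prime_p by (simp add: prime_gt_0_nat)
qed

end

section \<open>Compact groups and the lower p-series\<close>

lemma (in group) set_mult_normal:
  assumes A: "A \<lhd> G" and B: "B \<lhd> G"
  shows "A <#> B \<lhd> G"
proof (rule normal_invI)
  show "subgroup (A <#> B) G"
    using mult_norm_subgroup[OF A] B normal_imp_subgroup by blast
next
  fix g h assume g: "g \<in> carrier G" and h: "h \<in> A <#> B"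
  then obtain a b where ab: "a \<in> A" "b \<in> B" "h = a \<otimes> b" by (auto simp: set_mult_def)
  have c: "a \<in> carrier G" "b \<in> carrier G"
    using ab A B normal_imp_subgroup subgroup.mem_carrier by metis+
  have "g \<otimes> h \<otimes> inv g = (g \<otimes> a \<otimes> inv g) \<otimes> (g \<otimes> b \<otimes> inv g)"
    using g c ab by (simp add: m_assoc mult_inv_cancel)
  moreover have "g \<otimes> a \<otimes> inv g \<in> A" "g \<otimes> b \<otimes> inv g \<in> B"
    using normal.inv_op_closed2[OF A g ab(1)] normal.inv_op_closed2[OF B g ab(2)] by auto
  ultimately show "g \<otimes> h \<otimes> inv g \<in> A <#> B" by (auto simp: set_mult_def)
qed

locale topgroup = group G for G (structure) +
  fixes T :: "'a topology"
  assumes topgroup: "topological_group G T"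
begin

lemma topspace: "topspace T = carrier G"
  using topgroup by (simp add: topological_group_def)

lemma continuous_mult:
  assumes "continuous_map X T f" "continuous_map X T g"
  shows "continuous_map X T (\<lambda>x. f x \<otimes> g x)"
proof -
  have "continuous_map (prod_topology T T) T (\<lambda>(x, y). x \<otimes> y)"
    using topgroup by (simp add: topological_group_def)
  from continuous_map_compose[OF continuous_map_pairedI[OF assms] this]
  show ?thesis by (simp add: o_def)
qed

lemma continuous_inv:
  assumes "continuous_map X T f"
  shows "continuous_map X T (\<lambda>x. inv f x)"
proof -
  have "continuous_map T T (\<lambda>x. inv x)"
    using topgroup by (simp add: topological_group_def)
  from continuous_map_compose[OF assms this] show ?thesis by (simp add: o_def)
qed

lemma continuous_const: "c \<in> carrier G \<Longrightarrow> continuous_map X T (\<lambda>_. c)"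
  by (simp add: topspace)

lemma continuous_pow:
  assumes "continuous_map X T f"
  shows "continuous_map X T (\<lambda>x. f x [^] (n :: nat))"
proof (induction n)
  case 0
  show ?case by (simp add: topspace)
next
  case (Suc n)
  show ?case using continuous_mult[OF Suc assms] by simp
qed

lemma preimage_closed:
  assumes "continuous_map T T f" "closedin T C"
  shows "closedin T {x \<in> carrier G. f x \<in> C}"
  using closedin_continuous_map_preimage[OF assms] by (simp add: topspace)

lemma preimage_open:
  assumes "continuous_map T T f" "openin T C"
  shows "openin T {x \<in> carrier G. f x \<in> C}"
  using openin_continuous_map_preimage[OF assms] by (simp add: topspace)

lemma continuous_id: "continuous_map T T (\<lambda>x. x)"
  by simp

lemma coset_eq_preimage:
  assumes "subgroup H G" "g \<in> carrier G"
  shows "H #> g = {x \<in> carrier G. x \<otimes> inv g \<in> H}"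
  using subgroup.rcos_module[OF assms(1) group_axioms assms(2)]
    r_coset_subset_G[OF subgroup.subset[OF assms(1)] assms(2)] by blast

lemma coset_closed:
  assumes "subgroup H G" "closedin T H" "g \<in> carrier G"
  shows "closedin T (H #> g)"
  unfolding coset_eq_preimage[OF assms(1,3)]
  using assms by (intro preimage_closed continuous_mult continuous_id continuous_const) auto

lemma coset_open:
  assumes "subgroup H G" "openin T H" "g \<in> carrier G"
  shows "openin T (H #> g)"
  unfolding coset_eq_preimage[OF assms(1,3)]
  using assms by (intro preimage_open continuous_mult continuous_id continuous_const) auto

lemma closure_carrier: "T closure_of A \<subseteq> carrier G"
  using closure_of_subset_topspace[of T A] topspace by simp

lemma closure_subset: "A \<subseteq> carrier G \<Longrightarrow> A \<subseteq> T closure_of A"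
  by (rule closure_of_subset) (simp add: topspace)

lemma closure_subgroup:
  assumes H: "subgroup H G"
  shows "subgroup (T closure_of H) G"
proof
  have sub: "H \<subseteq> T closure_of H"
    using subgroup.subset[OF H] by (rule closure_subset)
  show "T closure_of H \<subseteq> carrier G" by (rule closure_carrier)
  show "\<one> \<in> T closure_of H" using sub subgroup.one_closed[OF H] by blast
  fix x assume x: "x \<in> T closure_of H"
  have "m_inv G ` (T closure_of H) \<subseteq> T closure_of (m_inv G ` H)"
    by (intro continuous_map_image_closure_subset continuous_inv continuous_id)
  also have "\<dots> \<subseteq> T closure_of H"
    using subgroup.m_inv_closed[OF H] by (intro closure_of_mono) blast
  finally show "inv x \<in> T closure_of H" using x by blast
  fix y assume y: "y \<in> T closure_of H"
  let ?m = "\<lambda>z. fst z \<otimes> snd z"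
  have "?m ` (prod_topology T T closure_of (H \<times> H)) \<subseteq> T closure_of (?m ` (H \<times> H))"
    by (intro continuous_map_image_closure_subset continuous_mult continuous_map_fst continuous_map_snd)
  also have "\<dots> \<subseteq> T closure_of H"
    using subgroup.m_closed[OF H] by (intro closure_of_mono) auto
  finally have "?m ` ((T closure_of H) \<times> (T closure_of H)) \<subseteq> T closure_of H"
    by (simp add: closure_of_Times)
  moreover have "x \<otimes> y = ?m (x, y)" by simp
  ultimately show "x \<otimes> y \<in> T closure_of H" using x y by (metis (no_types, lifting) SigmaI image_subset_iff)
qed

lemma closure_normal:
  assumes N: "N \<lhd> G"
  shows "T closure_of N \<lhd> G"
proof (rule normal_invI)
  show "subgroup (T closure_of N) G"
    using N normal_imp_subgroup closure_subgroup by blast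
  fix g x assume g: "g \<in> carrier G" and x: "x \<in> T closure_of N"
  have "(\<lambda>x. g \<otimes> x \<otimes> inv g) ` (T closure_of N) \<subseteq> T closure_of ((\<lambda>x. g \<otimes> x \<otimes> inv g) ` N)"
    using g by (intro continuous_map_image_closure_subset continuous_mult continuous_id continuous_const) auto
  also have "\<dots> \<subseteq> T closure_of N"
    using normal.inv_op_closed2[OF N g] by (intro closure_of_mono) blast
  finally show "g \<otimes> x \<otimes> inv g \<in> T closure_of N" using x by blast
qed

lemma generate_closure_subset:
  assumes "S \<subseteq> H" "subgroup H G" "closedin T H"
  shows "T closure_of generate G S \<subseteq> H"
  using closure_of_minimal[OF generate_subgroup_incl[OF assms(1,2)] assms(3)] .

text \<open>The set is a continuous image of the compact set \<open>A \<times> B\<close>, hence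
  compact, hence closed in a Hausdorff space. It is applied with \<open>f\<close> the
  \<open>p\<close>-th power map and with the identity.\<close>

lemma closedin_mult_image:
  assumes "compact_space T" "Hausdorff_space T" "closedin T A" "closedin T B" "continuous_map T T f"
  shows "closedin T {w \<otimes> f a | a w. a \<in> A \<and> w \<in> B}"
proof -
  have c: "compactin T A" "compactin T B"
    using assms closedin_compact_space by auto
  then have "compactin (prod_topology T T) (A \<times> B)"
    by (simp add: compactin_Times)
  moreover have "continuous_map (prod_topology T T) T (\<lambda>z. snd z \<otimes> f (fst z))"
    by (intro continuous_mult continuous_map_snd
        continuous_map_compose[OF continuous_map_fst assms(5), unfolded o_def])
  ultimately have "compactin T ((\<lambda>z. snd z \<otimes> f (fst z)) ` (A \<times> B))"
    by (rule image_compactin)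
  moreover have "(\<lambda>z. snd z \<otimes> f (fst z)) ` (A \<times> B) = {w \<otimes> f a | a w. a \<in> A \<and> w \<in> B}"
    by force
  ultimately show ?thesis using compactin_imp_closedin[OF assms(2)] by simp
qed

lemma open_subgroup_superset:
  assumes V: "openin T V" and V1: "\<one> \<in> V" and VH: "V \<subseteq> H" and H: "subgroup H G"
  shows "openin T H"
proof (subst openin_subopen, intro ballI)
  fix h assume h: "h \<in> H"
  then have hc: "h \<in> carrier G" using H subgroup.mem_carrier by metis
  let ?V = "{x \<in> carrier G. x \<otimes> inv h \<in> V}"
  have "openin T ?V"
    using hc V by (intro preimage_open continuous_mult continuous_id continuous_const) auto
  moreover have "h \<in> ?V" using hc V1 by simp
  moreover have "?V \<subseteq> H"
  proof
    fix x assume "x \<in> ?V"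
    then have "x \<in> carrier G" "x \<otimes> inv h \<in> H" using VH by auto
    then have "x \<otimes> inv h \<otimes> h \<in> H" using h subgroup.m_closed[OF H] by blast
    then show "x \<in> H" using \<open>x \<in> carrier G\<close> hc by (simp add: m_assoc)
  qed
  ultimately show "\<exists>S. openin T S \<and> h \<in> S \<and> S \<subseteq> H" by blast
qed

lemma open_subgroup_closed:
  assumes H: "subgroup H G" and op: "openin T H"
  shows "closedin T H"
proof -
  have "carrier G - H = \<Union>{H #> g | g. g \<in> carrier G - H}"
  proof
    show "carrier G - H \<subseteq> \<Union>{H #> g | g. g \<in> carrier G - H}"
      using rcos_self[OF _ H] by blast
    have "x \<in> carrier G - H" if "g \<in> carrier G - H" "x \<in> H #> g" for g x
    proof -
      have x: "x \<in> carrier G" "x \<otimes> inv g \<in> H"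
        using that coset_eq_preimage[OF H, of g] by auto
      have "x \<notin> H"
      proof
        assume "x \<in> H"
        then have "inv x \<otimes> (x \<otimes> inv g) \<in> H"
          using x subgroup.m_closed[OF H] subgroup.m_inv_closed[OF H] by blast
        then have "inv g \<in> H" using x that by (simp add: mult_inv_cancel)
        then have "inv (inv g) \<in> H" by (rule subgroup.m_inv_closed[OF H])
        then show False using that by simp
      qed
      then show ?thesis using x by simp
    qed
    then show "\<Union>{H #> g | g. g \<in> carrier G - H} \<subseteq> carrier G - H" by blast
  qed
  moreover have "openin T (\<Union>{H #> g | g. g \<in> carrier G - H})"
    using coset_open[OF H op] by (intro openin_Union) blast
  ultimately have "openin T (carrier G - H)" by (simp only:)
  then show ?thesis
    using subgroup.subset[OF H] by (simp add: closedin_def topspace)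
qed

lemma open_subgroup_finite_index:
  assumes "compact_space T" and H: "subgroup H G" and op: "openin T H"
  shows "finite (rcosets H)"
proof -
  have "\<exists>F. finite F \<and> F \<subseteq> rcosets H \<and> carrier G \<subseteq> \<Union>F"
  proof (rule compactinD)
    show "compactin T (carrier G)" using assms(1) topspace by (simp add: compact_space_def)
    show "carrier G \<subseteq> \<Union>(rcosets H)" using rcosets_part_G[OF H] by simp
    show "openin T C" if "C \<in> rcosets H" for C
      using that coset_open[OF H op] by (auto simp: RCOSETS_def)
  qed
  then obtain F where F: "finite F" "F \<subseteq> rcosets H" "carrier G \<subseteq> \<Union>F" by blast
  have "rcosets H \<subseteq> F"
  proof
    fix C assume C: "C \<in> rcosets H"
    then obtain x where x: "x \<in> C" using subgroup.rcosets_non_empty[OF H C] by blast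
    then have "x \<in> carrier G" using subgroup.rcosets_carrier[OF H group_axioms C] by blast
    then obtain D where D: "D \<in> F" "x \<in> D" using F by blast
    then have "C = D"
      using rcos_disjoint[OF H] C F(2) x unfolding pairwise_def disjnt_def by blast
    then show "C \<in> F" using D by simp
  qed
  then show ?thesis using F finite_subset by blast
qed

end

section \<open>Normality and generation of the terms of the lower p-series\<close>

lemma (in group) commutator_subgroup_normal:
  assumes H: "H \<lhd> G"
  shows "commutator_subgroup G H (carrier G) \<lhd> G"
  unfolding commutator_subgroup_def
proof (rule normal_generateI)
  have Hc: "h \<in> H \<Longrightarrow> h \<in> carrier G" for h
    using H normal_imp_subgroup subgroup.mem_carrier by metis
  show "{h \<otimes> k \<otimes> inv h \<otimes> inv k |h k. h \<in> H \<and> k \<in> carrier G} \<subseteq> carrier G"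
    using Hc by auto
  fix c g assume "c \<in> {h \<otimes> k \<otimes> inv h \<otimes> inv k |h k. h \<in> H \<and> k \<in> carrier G}" and g: "g \<in> carrier G"
  then obtain h k where hk: "h \<in> H" "k \<in> carrier G" "c = h \<otimes> k \<otimes> inv h \<otimes> inv k" by blast
  let ?h = "g \<otimes> h \<otimes> inv g" and ?k = "g \<otimes> k \<otimes> inv g"
  have "g \<otimes> c \<otimes> inv g = ?h \<otimes> ?k \<otimes> inv ?h \<otimes> inv ?k"
    using hk g Hc by (simp add: m_assoc inv_mult_group mult_inv_cancel)
  moreover have "?h \<in> H" using normal.inv_op_closed2[OF H g hk(1)] .
  moreover have "?k \<in> carrier G" using g hk by simp
  ultimately show "g \<otimes> c \<otimes> inv g \<in> {h \<otimes> k \<otimes> inv h \<otimes> inv k |h k. h \<in> H \<and> k \<in> carrier G}" by blast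
qed

lemma (in group) conj_pow:
  assumes "g \<in> carrier G" "h \<in> carrier G"
  shows "(g \<otimes> h \<otimes> inv g) [^] (n::nat) = g \<otimes> h [^] n \<otimes> inv g"
  using assms by (induction n) (simp_all add: m_assoc mult_inv_cancel)

lemma (in group) power_subgroup_normal:
  assumes H: "H \<lhd> G"
  shows "power_subgroup G H n \<lhd> G"
  unfolding power_subgroup_def
proof (rule normal_generateI)
  have Hc: "h \<in> H \<Longrightarrow> h \<in> carrier G" for h
    using H normal_imp_subgroup subgroup.mem_carrier by metis
  show "(\<lambda>h. h [^] n) ` H \<subseteq> carrier G" using Hc by auto
  fix c g assume "c \<in> (\<lambda>h. h [^] n) ` H" and g: "g \<in> carrier G"
  then obtain h where h: "h \<in> H" "c = h [^] n" by blast
  then have "g \<otimes> c \<otimes> inv g = (g \<otimes> h \<otimes> inv g) [^] n" using g Hc by (simp add: conj_pow)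
  moreover have "g \<otimes> h \<otimes> inv g \<in> H" using normal.inv_op_closed2[OF H g h(1)] .
  ultimately show "g \<otimes> c \<otimes> inv g \<in> (\<lambda>h. h [^] n) ` H" by blast
qed

context topgroup
begin

lemma lps_Suc_normal: "lower_p_series p G T (Suc n) \<lhd> G"
proof (induction n)
  case 0
  then show ?case by (simp add: normal_self)
next
  case (Suc n)
  then show ?case
    by (simp only: lower_p_series.simps)
      (intro closure_normal set_mult_normal power_subgroup_normal commutator_subgroup_normal)
qed

lemma lps_normal: "lower_p_series p G T i \<lhd> G"
  using lps_Suc_normal by (cases i) (auto simp: normal_self)

lemma carrier_closed: "closedin T (carrier G)"
  using closedin_topspace[of T] topspace by simp

lemma lps_closed: "closedin T (lower_p_series p G T i)"
proof (cases i)
  case (Suc n)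
  then show ?thesis by (cases n) (simp_all add: carrier_closed)
qed (simp add: carrier_closed)

lemma lps_generators:
  fixes n p :: nat
  defines "L \<equiv> lower_p_series p G T (Suc n)" and "L' \<equiv> lower_p_series p G T (Suc (Suc n))"
  shows "x \<in> L \<Longrightarrow> x [^] p \<in> L'" "x \<in> L \<Longrightarrow> u \<in> carrier G \<Longrightarrow> x \<otimes> u \<otimes> inv x \<otimes> inv u \<in> L'"
proof -
  let ?A = "power_subgroup G L p" and ?B = "commutator_subgroup G L (carrier G)"
  have L: "L \<lhd> G" unfolding L_def by (rule lps_Suc_normal)
  have sA: "subgroup ?A G" using power_subgroup_normal[OF L] normal_imp_subgroup by blast
  have sB: "subgroup ?B G" using commutator_subgroup_normal[OF L] normal_imp_subgroup by blast
  note c = subgroup.mem_carrier[OF sA] subgroup.mem_carrier[OF sB]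
  have "?A <#> ?B \<subseteq> carrier G"
    using setmult_subset_G[OF subgroup.subset[OF sA] subgroup.subset[OF sB]] .
  then have AB: "?A <#> ?B \<subseteq> L'"
    using closure_subset unfolding L'_def L_def by simp
  show "x [^] p \<in> L'" if "x \<in> L"
  proof -
    have "x [^] p \<in> ?A" unfolding power_subgroup_def using that by (intro generate.incl) blast
    then have "x [^] p \<otimes> \<one> \<in> ?A <#> ?B" using subgroup.one_closed[OF sB] by (auto simp: set_mult_def)
    moreover have "x [^] p \<otimes> \<one> = x [^] p" using c(1)[OF \<open>x [^] p \<in> ?A\<close>] by simp
    ultimately show ?thesis using AB by auto
  qed
  show "x \<otimes> u \<otimes> inv x \<otimes> inv u \<in> L'" if "x \<in> L" "u \<in> carrier G"
  proof -
    let ?c = "x \<otimes> u \<otimes> inv x \<otimes> inv u"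
    have "?c \<in> ?B" unfolding commutator_subgroup_def using that by (intro generate.incl) blast
    then have "\<one> \<otimes> ?c \<in> ?A <#> ?B" using subgroup.one_closed[OF sA] by (auto simp: set_mult_def)
    moreover have "\<one> \<otimes> ?c = ?c" using c(2)[OF \<open>?c \<in> ?B\<close>] by simp
    ultimately show ?thesis using AB by auto
  qed
qed

text \<open>Together with \<open>lps_generators\<close> this describes the next term as the least
  closed subgroup containing the stated elements. Later inclusions of a term in a subgroup are
  obtained by choosing \<open>M\<close> suitably.\<close>

lemma lps_least:
  assumes M: "subgroup M G" "closedin T M"
    and "\<And>x. x \<in> lower_p_series p G T (Suc n) \<Longrightarrow> x [^] p \<in> M"
    and "\<And>x u. x \<in> lower_p_series p G T (Suc n) \<Longrightarrow> u \<in> carrier G \<Longrightarrow> x \<otimes> u \<otimes> inv x \<otimes> inv u \<in> M"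
  shows "lower_p_series p G T (Suc (Suc n)) \<subseteq> M"
proof -
  let ?L = "lower_p_series p G T (Suc n)"
  have "power_subgroup G ?L p \<subseteq> M" "commutator_subgroup G ?L (carrier G) \<subseteq> M"
    unfolding power_subgroup_def commutator_subgroup_def
    by (rule generate_subgroup_incl; use assms in blast)+
  then have "power_subgroup G ?L p <#> commutator_subgroup G ?L (carrier G) \<subseteq> M"
    using subgroup.m_closed[OF M(1)] by (auto simp: set_mult_def)
  then show ?thesis using closure_of_minimal M(2) by simp
qed

lemma lps_filtration:
  assumes "prime p"
  shows "p_filtration G p (\<lambda>n. lower_p_series p G T (Suc n))"
proof (intro p_filtration.intro p_filtration_axioms.intro)
  show "group G" by (rule group_axioms)
  show "prime p" by fact
  show "lower_p_series p G T (Suc 0) = carrier G" by simp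
  fix n :: nat
  show "lower_p_series p G T (Suc n) \<lhd> G" by (rule lps_Suc_normal)
  fix x assume x: "x \<in> lower_p_series p G T (Suc n)"
  show "x [^] p \<in> lower_p_series p G T (Suc (Suc n))" using x by (rule lps_generators)
  fix u assume "u \<in> carrier G"
  with x show "x \<otimes> u \<otimes> inv x \<otimes> inv u \<in> lower_p_series p G T (Suc (Suc n))"
    by (rule lps_generators)
next
  fix n :: nat
  show "lower_p_series p G T (Suc (Suc n)) \<subseteq> lower_p_series p G T (Suc n)"
  proof (rule lps_least[OF _ lps_closed])
    have L: "lower_p_series p G T (Suc n) \<lhd> G" by (rule lps_Suc_normal)
    then show s: "subgroup (lower_p_series p G T (Suc n)) G" by (rule normal_imp_subgroup)
    fix x assume x: "x \<in> lower_p_series p G T (Suc n)"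
    show "x [^] p \<in> lower_p_series p G T (Suc n)"
    proof -
      have "x [^] m \<in> lower_p_series p G T (Suc n)" for m :: nat
        using x subgroup.m_closed[OF s] subgroup.one_closed[OF s] by (induction m) simp_all
      then show ?thesis .
    qed
    fix u assume u: "u \<in> carrier G"
    have xc: "x \<in> carrier G" using x subgroup.mem_carrier[OF s] by simp
    have "u \<otimes> inv x \<otimes> inv u \<in> lower_p_series p G T (Suc n)"
      using normal.inv_op_closed2[OF L u] subgroup.m_inv_closed[OF s x] by simp
    then have "x \<otimes> (u \<otimes> inv x \<otimes> inv u) \<in> lower_p_series p G T (Suc n)"
      using x subgroup.m_closed[OF s] by blast
    then show "x \<otimes> u \<otimes> inv x \<otimes> inv u \<in> lower_p_series p G T (Suc n)"
      using xc u by (simp add: m_assoc)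
  qed
qed

end

section \<open>Uniformly powerful groups\<close>

locale uniform_pro_p = topgroup +
  fixes p :: nat
  assumes p_prime: "prime p" and uniform: "uniformly_powerful p G T"
begin

text \<open>The index is shifted: \<open>W n\<close> is \<open>P\<^sub>n\<^sub>+\<^sub>1\<close>, so that \<open>p ^ n\<close>-th powers lie in \<open>W n\<close>.\<close>

definition W :: "nat \<Rightarrow> 'a set" where "W n = lower_p_series p G T (Suc n)"

sublocale p_filtration G p W
proof -
  have "W = (\<lambda>n. lower_p_series p G T (Suc n))" by (simp add: W_def fun_eq_iff)
  then show "p_filtration G p W" using lps_filtration[OF p_prime] by simp
qed

lemma W_closed: "closedin T (W n)"
  unfolding W_def by (rule lps_closed)

lemma W_least:
  assumes "subgroup M G" "closedin T M" "\<And>x. x \<in> W n \<Longrightarrow> x [^] p \<in> M"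
    and "\<And>x u. x \<in> W n \<Longrightarrow> u \<in> carrier G \<Longrightarrow> x \<otimes> u \<otimes> inv x \<otimes> inv u \<in> M"
  shows "W (Suc n) \<subseteq> M"
  using assms unfolding W_def by (rule lps_least)

lemma compact: "compact_space T" and Hausdorff: "Hausdorff_space T"
  and small_open_subgroup: "openin T V \<Longrightarrow> \<one> \<in> V \<Longrightarrow> \<exists>H. subgroup H G \<and> openin T H \<and> H \<subseteq> V"
  and open_normal_index: "N \<lhd> G \<Longrightarrow> openin T N \<Longrightarrow> \<exists>k. card (rcosets N) = p ^ k"
  and powerful: "commutator_subgroup G (carrier G) (carrier G) \<subseteq>
       T closure_of (power_subgroup G (carrier G) (if p = 2 then 4 else p))"
  and torsion: "x \<in> carrier G \<Longrightarrow> 0 < n \<Longrightarrow> x [^] (n::nat) = \<one> \<Longrightarrow> x = \<one>"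
  using uniform
  unfolding uniformly_powerful_def pro_p_group_def profinite_group_def powerful_def
    torsion_free_def group_index_def by blast+

text \<open>The preimage in \<open>G\<close> of the image of the power map modulo
  \<open>W (Suc (Suc n))\<close>; surjectivity onto the next layer means that it contains
  \<open>W (Suc n)\<close>. Writing it as a product of two sets makes its closedness a matter of
  compactness.\<close>

definition pow_set :: "nat \<Rightarrow> 'a set" where
  "pow_set n = {w \<otimes> y [^] p | y w. y \<in> W n \<and> w \<in> W (Suc (Suc n))}"

lemma pow_set_iff:
  "z \<in> pow_set n \<longleftrightarrow> z \<in> carrier G \<and> (\<exists>y\<in>W n. W (Suc (Suc n)) #> (y [^] p) = W (Suc (Suc n)) #> z)"
proof
  assume "z \<in> pow_set n"
  then obtain y w where yw: "y \<in> W n" "w \<in> W (Suc (Suc n))" "z = w \<otimes> y [^] p"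
    by (auto simp: pow_set_def)
  have c: "y \<in> carrier G" "w \<in> carrier G" using yw W_carrier by auto
  have "y [^] p \<otimes> inv z = inv w" using c yw by (simp add: inv_mult_group mult_inv_cancel)
  then have "y [^] p \<otimes> inv z \<in> W (Suc (Suc n))"
    using subgroup.m_inv_closed[OF W_subgroup yw(2)] by simp
  moreover have "z \<in> carrier G" using c yw by simp
  ultimately show "z \<in> carrier G \<and> (\<exists>y\<in>W n. W (Suc (Suc n)) #> (y [^] p) = W (Suc (Suc n)) #> z)"
    using yw(1) c W_coset_eq_iff by blast
next
  assume "z \<in> carrier G \<and> (\<exists>y\<in>W n. W (Suc (Suc n)) #> (y [^] p) = W (Suc (Suc n)) #> z)"
  then obtain y where y: "y \<in> W n" "W (Suc (Suc n)) #> z = W (Suc (Suc n)) #> (y [^] p)"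
    and z: "z \<in> carrier G" by auto
  have c: "y \<in> carrier G" using y W_carrier by auto
  then have "z \<otimes> inv (y [^] p) \<in> W (Suc (Suc n))" using y W_coset_eq_iff z by simp
  moreover have "z = z \<otimes> inv (y [^] p) \<otimes> y [^] p" using c z by (simp add: m_assoc)
  ultimately show "z \<in> pow_set n" using y(1) by (auto simp: pow_set_def)
qed

lemma pow_set_closed: "closedin T (pow_set n)"
  unfolding pow_set_def
  by (intro closedin_mult_image compact Hausdorff W_closed continuous_pow continuous_id)

lemma W_sub_pow_set: "W (Suc (Suc n)) \<subseteq> pow_set n"
proof
  fix w assume w: "w \<in> W (Suc (Suc n))"
  then have "w = w \<otimes> \<one> [^] p" using W_carrier by simp
  moreover have "\<one> \<in> W n" using W_subgroup subgroup.one_closed by blast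
  ultimately show "w \<in> pow_set n" using w unfolding pow_set_def by blast
qed

lemma pow_mem_pow_set: "y \<in> W n \<Longrightarrow> y [^] p \<in> pow_set n"
  using pow_set_iff W_carrier by blast

text \<open>Modulo \<open>W (Suc (Suc n))\<close> the power map on \<open>W n\<close> is a
  homomorphism, by \<open>W_pow_mult\<close>, so its image is a subgroup.\<close>

lemma pow_set_subgroup:
  assumes two: "\<And>x u. p = 2 \<Longrightarrow> x \<in> W n \<Longrightarrow> u \<in> carrier G \<Longrightarrow>
      x \<otimes> u \<otimes> inv x \<otimes> inv u \<in> W (Suc (Suc n))"
  shows "subgroup (pow_set n) G"
proof
  interpret N: normal "W (Suc (Suc n))" G by (rule W_normal)
  show "pow_set n \<subseteq> carrier G" using pow_set_iff by blast
  show "\<one> \<in> pow_set n"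
    using W_sub_pow_set subgroup.one_closed[OF W_subgroup] by blast
  fix z assume "z \<in> pow_set n"
  then obtain y where z: "z \<in> carrier G" and y: "y \<in> W n" "y \<in> carrier G"
      "W (Suc (Suc n)) #> (y [^] p) = W (Suc (Suc n)) #> z"
    using pow_set_iff W_carrier by blast
  have "W (Suc (Suc n)) #> (inv y [^] p) = W (Suc (Suc n)) #> inv z"
    using N.coset_inv_cong[OF _ z y(3)] y(2) by (simp add: nat_pow_inv)
  moreover have "inv y \<in> W n" using subgroup.m_inv_closed[OF W_subgroup y(1)] .
  ultimately show "inv z \<in> pow_set n" using pow_set_iff z by blast
  fix z' assume "z' \<in> pow_set n"
  then obtain y' where z': "z' \<in> carrier G" and y': "y' \<in> W n" "y' \<in> carrier G"
      "W (Suc (Suc n)) #> (y' [^] p) = W (Suc (Suc n)) #> z'"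
    using pow_set_iff W_carrier by blast
  have "W (Suc (Suc n)) #> ((y \<otimes> y') [^] p) = W (Suc (Suc n)) #> (y [^] p \<otimes> y' [^] p)"
    using W_pow_mult[OF y(2) y'(1)] two y(1) y'(2) by blast
  also have "\<dots> = W (Suc (Suc n)) #> (z \<otimes> z')"
    using y y' z z' by (intro N.coset_mult_cong) auto
  finally have "W (Suc (Suc n)) #> ((y \<otimes> y') [^] p) = W (Suc (Suc n)) #> (z \<otimes> z')" .
  moreover have "y \<otimes> y' \<in> W n" using subgroup.m_closed[OF W_subgroup y(1) y'(1)] .
  ultimately show "z \<otimes> z' \<in> pow_set n" using pow_set_iff z z' by blast
qed

text \<open>Leastness of \<open>W (Suc n)\<close> reduces surjectivity to commutators, since
  \<open>p\<close>-th powers are in \<open>pow_set n\<close> by construction.\<close>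

lemma W_sub_pow_setI:
  assumes two: "\<And>x u. p = 2 \<Longrightarrow> x \<in> W n \<Longrightarrow> u \<in> carrier G \<Longrightarrow>
      x \<otimes> u \<otimes> inv x \<otimes> inv u \<in> W (Suc (Suc n))"
    and odd: "\<And>x u. p \<noteq> 2 \<Longrightarrow> x \<in> W n \<Longrightarrow> u \<in> carrier G \<Longrightarrow>
      x \<otimes> u \<otimes> inv x \<otimes> inv u \<in> pow_set n"
  shows "W (Suc n) \<subseteq> pow_set n"
proof (rule W_least[OF pow_set_subgroup pow_set_closed])
  fix x u assume "x \<in> W n" "u \<in> carrier G"
  then show "x \<otimes> u \<otimes> inv x \<otimes> inv u \<in> pow_set n"
    using two odd W_sub_pow_set by (cases "p = 2") blast+
qed (use two pow_mem_pow_set in auto)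

text \<open>Here \<open>inv y \<otimes> t\<close> is the conjugate of \<open>inv y\<close> by \<open>u\<close>, so the commutator of \<open>y ^ p\<close> and \<open>u\<close> is
  \<open>y ^ p \<otimes> (inv y \<otimes> t) ^ p\<close>, and the collection formula applies.\<close>

lemma commutator_of_power:
  assumes y: "y \<in> W n" and u: "u \<in> carrier G" and t: "t = y \<otimes> u \<otimes> inv y \<otimes> inv u"
    and z: "z \<in> carrier G" "W (Suc (Suc n)) #> (y [^] p) = W (Suc (Suc n)) #> z"
    and two: "p = 2 \<Longrightarrow> t \<in> W (Suc (Suc n))"
  shows "W (Suc (Suc (Suc n))) #> (t [^] p) = W (Suc (Suc (Suc n))) #> (z \<otimes> u \<otimes> inv z \<otimes> inv u)"
proof -
  let ?W = "W (Suc (Suc (Suc n)))"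
  interpret N: normal ?W G by (rule W_normal)
  have yc: "y \<in> carrier G" using y by (rule W_carrier)
  have tW: "t \<in> W (Suc n)" using W_comm[OF y u] t by simp
  have tc: "t \<in> carrier G" using t yc u by simp
  \<comment> \<open>The element \<open>z\<close> is only congruent to \<open>y [^] p\<close>. The
    discrepancy \<open>w\<close> is central modulo \<open>?W\<close> and so drops out of the
    commutator.\<close>
  define w where "w = z \<otimes> inv (y [^] p)"
  have w: "w \<in> W (Suc (Suc n))" using z yc by (simp add: w_def flip: W_coset_eq_iff)
  have wc: "w \<in> carrier G" using w by (rule W_carrier)
  let ?Y = "y [^] p"
  have Yc: "?Y \<in> carrier G" using yc by simp
  have zw: "z = w \<otimes> ?Y" using z yc by (simp add: w_def m_assoc)
  define c where "c = ?Y \<otimes> u \<otimes> inv ?Y \<otimes> inv u"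
  have cc: "c \<in> carrier G" using yc u by (simp add: c_def)
  have "z \<otimes> u \<otimes> inv z \<otimes> inv u = (w \<otimes> c) \<otimes> (u \<otimes> inv w \<otimes> inv u)"
    unfolding zw c_def using wc Yc u by (simp add: m_assoc inv_mult_group mult_inv_cancel)
  then have "?W #> (z \<otimes> u \<otimes> inv z \<otimes> inv u) = ?W #> ((w \<otimes> c) \<otimes> (u \<otimes> inv w \<otimes> inv u))"
    by simp
  also have "\<dots> = ?W #> ((c \<otimes> w) \<otimes> (u \<otimes> inv w \<otimes> inv u))"
    using wc cc u W_central[OF w cc] by (intro N.coset_mult_cong[OF _ _ _ _ _ refl]) auto
  also have "\<dots> = ?W #> (c \<otimes> (w \<otimes> u \<otimes> inv w \<otimes> inv u))"
    using wc cc u by (simp add: m_assoc)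
  also have "\<dots> = ?W #> (c \<otimes> \<one>)"
    using wc cc u W_coset_one[OF W_comm[OF w u]] by (intro N.coset_mult_cong[OF _ _ _ _ refl]) auto
  finally have 1: "?W #> (z \<otimes> u \<otimes> inv z \<otimes> inv u) = ?W #> c" using cc by simp
  have conj: "u \<otimes> inv ?Y \<otimes> inv u = (inv y \<otimes> t) [^] p"
  proof -
    have "inv y \<otimes> t = u \<otimes> inv y \<otimes> inv u"
      unfolding t using yc u by (simp add: m_assoc mult_inv_cancel)
    then show ?thesis using conj_pow[OF u, of "inv y" p] yc by (simp add: nat_pow_inv)
  qed
  have comm: "inv y \<otimes> t \<otimes> inv (inv y) \<otimes> inv t \<in> ?W" if "p = 2"
    using W_central[OF two[OF that], of "inv y"] N.coset_comm_iff[of "inv y" t] yc tc by simp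
  have "c = ?Y \<otimes> (u \<otimes> inv ?Y \<otimes> inv u)" using yc u by (simp add: c_def m_assoc)
  also have "?W #> \<dots> = ?W #> (?Y \<otimes> (inv y [^] p \<otimes> t [^] p))"
    unfolding conj using W_pow_mult[OF _ tW comm] yc tc
    by (intro N.coset_mult_cong[OF _ _ _ _ refl]) auto
  finally have "?W #> c = ?W #> (t [^] p)"
    using yc tc by (simp add: nat_pow_inv mult_inv_cancel)
  then show ?thesis using 1 by simp
qed

text \<open>The two claims feed each other, hence the joint induction. Surjectivity writes an
  element \<open>z\<close> of \<open>W (Suc n)\<close> as \<open>y [^] p\<close> modulo the next
  term; its commutator with \<open>u\<close> is then congruent to \<open>t [^] p\<close>, where
  \<open>t\<close> is the commutator of \<open>y\<close> and \<open>u\<close>. For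
  \<open>p = 2\<close> the first claim puts \<open>t\<close> one layer deeper, and its power
  follows.\<close>

lemma W_two_onto:
  "(p = 2 \<longrightarrow> (\<forall>x\<in>W n. \<forall>u\<in>carrier G. x \<otimes> u \<otimes> inv x \<otimes> inv u \<in> W (Suc (Suc n)))) \<and>
   W (Suc n) \<subseteq> pow_set n"
proof (induction n)
  case 0
  have gen: "x \<otimes> u \<otimes> inv x \<otimes> inv u \<in> T closure_of (power_subgroup G (carrier G) (if p = 2 then 4 else p))"
    if "x \<in> W 0" "u \<in> carrier G" for x u
  proof -
    have "x \<otimes> u \<otimes> inv x \<otimes> inv u \<in> commutator_subgroup G (carrier G) (carrier G)"
      unfolding commutator_subgroup_def using that W_0 by (intro generate.incl) blast
    then show ?thesis using powerful by blast
  qed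
  \<comment> \<open>Here \<open>4 = p * p\<close>, and two \<open>p\<close>-th powers lead down two
    steps of the filtration.\<close>
  have two: "x \<otimes> u \<otimes> inv x \<otimes> inv u \<in> W (Suc (Suc 0))"
    if p2: "p = 2" and xu: "x \<in> W 0" "u \<in> carrier G" for x u
  proof -
    have "x [^] (4::nat) \<in> W (Suc (Suc 0))" if x: "x \<in> carrier G" for x
    proof -
      have "(x [^] p) [^] p \<in> W (Suc (Suc 0))"
        using W_pow[OF W_pow, of x 0] x W_0 by simp
      then show ?thesis using x p2 by (simp add: nat_pow_pow)
    qed
    then have "T closure_of (power_subgroup G (carrier G) 4) \<subseteq> W (Suc (Suc 0))"
      unfolding power_subgroup_def
      by (intro generate_closure_subset W_subgroup W_closed) auto
    then show ?thesis using gen[OF xu] p2 by auto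
  qed
  have "x \<otimes> u \<otimes> inv x \<otimes> inv u \<in> pow_set 0"
    if odd: "p \<noteq> 2" and xu: "x \<in> W 0" "u \<in> carrier G" for x u
  proof -
    have "(\<lambda>h. h [^] p) ` carrier G \<subseteq> pow_set 0" using pow_mem_pow_set[of _ 0] W_0 by auto
    then have "T closure_of (power_subgroup G (carrier G) p) \<subseteq> pow_set 0"
      unfolding power_subgroup_def using odd
      by (intro generate_closure_subset pow_set_subgroup pow_set_closed) auto
    then show ?thesis using gen[OF xu] odd by auto
  qed
  then show ?case using two W_sub_pow_setI[of 0] by blast
next
  case (Suc n)
  have step: "\<exists>t\<in>W (Suc n). (p = 2 \<longrightarrow> t \<in> W (Suc (Suc n))) \<and>
      W (Suc (Suc (Suc n))) #> (t [^] p) = W (Suc (Suc (Suc n))) #> (z \<otimes> u \<otimes> inv z \<otimes> inv u)"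
    if z: "z \<in> W (Suc n)" and u: "u \<in> carrier G" for z u
  proof -
    obtain y where y: "y \<in> W n" "W (Suc (Suc n)) #> (y [^] p) = W (Suc (Suc n)) #> z"
      using Suc z pow_set_iff by blast
    define t where "t = y \<otimes> u \<otimes> inv y \<otimes> inv u"
    have two: "t \<in> W (Suc (Suc n))" if "p = 2" using Suc that y u unfolding t_def by blast
    show ?thesis
      using commutator_of_power[OF y(1) u t_def W_carrier[OF z] y(2) two] W_comm[OF y(1) u] two
      unfolding t_def[symmetric] by blast
  qed
  have two: "z \<otimes> u \<otimes> inv z \<otimes> inv u \<in> W (Suc (Suc (Suc n)))"
    if p2: "p = 2" and zu: "z \<in> W (Suc n)" "u \<in> carrier G" for z u
  proof -
    let ?c = "z \<otimes> u \<otimes> inv z \<otimes> inv u"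
    have cc: "?c \<in> carrier G" using W_carrier[OF zu(1)] zu(2) by simp
    obtain t where t: "t \<in> W (Suc (Suc n))"
      "W (Suc (Suc (Suc n))) #> (t [^] p) = W (Suc (Suc (Suc n))) #> ?c"
      using step[OF zu] p2 by blast
    then have "W (Suc (Suc (Suc n))) #> ?c = W (Suc (Suc (Suc n))) #> \<one>"
      using W_coset_one[OF W_pow[OF t(1)]] by simp
    then have "?c \<otimes> inv \<one> \<in> W (Suc (Suc (Suc n)))"
      using W_coset_eq_iff[OF cc one_closed] by blast
    then show ?thesis using cc by simp
  qed
  \<comment> \<open>For every \<open>p\<close> the witness \<open>t\<close> lies in
    \<open>W (Suc n)\<close>, so the commutator is a \<open>p\<close>-th power of the kind that
    \<open>pow_set (Suc n)\<close> collects.\<close>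
  have "z \<otimes> u \<otimes> inv z \<otimes> inv u \<in> pow_set (Suc n)" if "z \<in> W (Suc n)" "u \<in> carrier G" for z u
    using step[OF that] W_carrier[OF that(1)] that(2) pow_set_iff by auto
  then show ?case using two W_sub_pow_setI[of "Suc n"] by blast
qed

text \<open>Induction on the index. The quotient by \<open>N\<close> is a finite p-group; if it is
  nontrivial, its central elements of order dividing \<open>p\<close> pull back to a subgroup
  \<open>M\<close> strictly larger than \<open>N\<close>. Powers and commutators of elements of
  \<open>M\<close> fall into \<open>N\<close>, so a term inside \<open>M\<close> is followed by a
  term inside \<open>N\<close>.\<close>

lemma open_normal_contains_W: "N \<lhd> G \<Longrightarrow> openin T N \<Longrightarrow> \<exists>n. W n \<subseteq> N"
proof (induction "card (rcosets N)" arbitrary: N rule: less_induct)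
  case less
  interpret N: normal N G by fact
  interpret Q: group "G Mod N" by (rule N.factorgroup_is_group)
  have ord: "order (G Mod N) = card (rcosets N)" by (simp add: order_def FactGroup_def)
  obtain k where k: "card (rcosets N) = p ^ k" using open_normal_index less.prems by blast
  show ?case
  proof (cases "k = 0")
    case True
    have "N = carrier G"
    proof
      show "N \<subseteq> carrier G" by (rule N.subset)
      show "carrier G \<subseteq> N"
      proof
        fix g assume g: "g \<in> carrier G"
        have "card (rcosets N) = 1" using k True by simp
        then have "N #> g = N #> \<one>"
          using rcosetsI[OF N.subset g] rcosetsI[OF N.subset one_closed] by (metis card_1_singletonE singletonD)
        then show "g \<in> N" using N.coset_eq_iff[OF group_axioms g one_closed] g by simp
      qed
    qed
    then show ?thesis using W_0 by blast
  next
    case False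
    obtain Z where Z: "Z \<in> carrier (G Mod N)" "Z \<noteq> \<one>\<^bsub>G Mod N\<^esub>" "Z [^]\<^bsub>G Mod N\<^esub> p = \<one>\<^bsub>G Mod N\<^esub>"
        "\<And>u. u \<in> carrier (G Mod N) \<Longrightarrow> Z \<otimes>\<^bsub>G Mod N\<^esub> u = u \<otimes>\<^bsub>G Mod N\<^esub> Z"
      using Q.p_group_central_element[OF p_prime, of k] ord k False by auto
    obtain z where z: "z \<in> carrier G" "Z = N #> z" using Z(1) by (auto simp: carrier_FactGroup)
    \<comment> \<open>the preimage of the central elements of order dividing \<open>p\<close> of the quotient by \<open>N\<close>\<close>
    define M where "M = {m \<in> carrier G. m [^] p \<in> N \<and> (\<forall>u\<in>carrier G. N #> (m \<otimes> u) = N #> (u \<otimes> m))}"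
    have N_iff: "a \<in> N \<longleftrightarrow> N #> a = N #> \<one>" if "a \<in> carrier G" for a
      using N.coset_eq_iff[OF group_axioms that one_closed] that by simp
    have N1: "N #> \<one> = N" by (rule coset_mult_one[OF N.subset])
    have zM: "z \<in> M"
    proof -
      have "N #> (z [^] p) = N #> \<one>"
        using Z(3) z N.FactGroup_pow[OF z(1), of p] N1 by simp
      moreover have "N #> (z \<otimes> u) = N #> (u \<otimes> z)" if "u \<in> carrier G" for u
        using Z(4)[of "N #> u"] that z by (simp add: carrier_FactGroup N.rcos_sum)
      ultimately show ?thesis using z N_iff[of "z [^] p"] by (simp add: M_def)
    qed
    have zN: "z \<notin> N" using Z(2) z N_iff[OF z(1)] N1 by simp
    have comm: "N #> (m \<otimes> u) = N #> (u \<otimes> m)" if "m \<in> M" "u \<in> carrier G" for m u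
      using that by (simp add: M_def)
    have Mc: "m \<in> carrier G" if "m \<in> M" for m using that by (simp add: M_def)
    have NM: "N \<subseteq> M"
    proof
      fix m assume m: "m \<in> N"
      then have mc: "m \<in> carrier G" by (rule N.mem_carrier)
      have "m [^] i \<in> N" for i :: nat using m by (induction i) auto
      moreover have "N #> (m \<otimes> u) = N #> (u \<otimes> m)" if u: "u \<in> carrier G" for u
      proof -
        have "N #> m = N #> \<one>" using N_iff[OF mc] m by blast
        then have "N #> (m \<otimes> u) = N #> (\<one> \<otimes> u)" "N #> (u \<otimes> m) = N #> (u \<otimes> \<one>)"
          using mc u N.coset_mult_cong[OF mc one_closed u u _ refl]
            N.coset_mult_cong[OF u u mc one_closed refl] by auto
        then show ?thesis using u by simp
      qed
      ultimately show "m \<in> M" using mc by (simp add: M_def)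
    qed
    have Msub: "subgroup M G"
    proof
      show "M \<subseteq> carrier G" using Mc by blast
      show "\<one> \<in> M" by (simp add: M_def)
      fix a assume a: "a \<in> M"
      note ac = Mc[OF a]
      have "a [^] p \<in> N" using a by (simp add: M_def)
      then have "inv a [^] p \<in> N" using ac by (simp add: nat_pow_inv)
      moreover have "N #> (inv a \<otimes> u) = N #> (u \<otimes> inv a)" if u: "u \<in> carrier G" for u
      proof -
        have "N #> (inv a \<otimes> (u \<otimes> a) \<otimes> inv a) = N #> (inv a \<otimes> (a \<otimes> u) \<otimes> inv a)"
          using comm[OF a u] ac u N.coset_mult_cong[OF _ _ _ _ refl, of "inv a" "u \<otimes> a" "a \<otimes> u"]
          by (intro N.coset_mult_cong[OF _ _ _ _ _ refl]) auto
        then show ?thesis using ac u by (simp add: m_assoc mult_inv_cancel)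
      qed
      ultimately show "inv a \<in> M" using ac by (simp add: M_def)
      fix b assume b: "b \<in> M"
      note bc = Mc[OF b]
      have "N #> ((a \<otimes> b) [^] p) = N #> (a [^] p \<otimes> b [^] p)"
        using N.coset_pow_mult_distrib[OF ac bc comm[OF a bc]] .
      also have "\<dots> = N #> \<one>"
      proof -
        have "a [^] p \<otimes> b [^] p \<in> N" using a b by (simp add: M_def)
        then show ?thesis using N_iff[of "a [^] p \<otimes> b [^] p"] ac bc by blast
      qed
      finally have "(a \<otimes> b) [^] p \<in> N" using N_iff[of "(a \<otimes> b) [^] p"] ac bc by simp
      moreover have "N #> (a \<otimes> b \<otimes> u) = N #> (u \<otimes> (a \<otimes> b))" if u: "u \<in> carrier G" for u
      proof -
        have "N #> (a \<otimes> (b \<otimes> u)) = N #> (a \<otimes> (u \<otimes> b))"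
          using N.coset_mult_cong[OF ac ac _ _ refl comm[OF b u]] bc u by simp
        moreover have "N #> (a \<otimes> u \<otimes> b) = N #> (u \<otimes> a \<otimes> b)"
          using N.coset_mult_cong[OF _ _ bc bc comm[OF a u] refl] ac u by simp
        ultimately show ?thesis using ac bc u by (simp add: m_assoc)
      qed
      ultimately show "a \<otimes> b \<in> M" using ac bc by (simp add: M_def)
    qed
    have Mnorm: "M \<lhd> G"
    proof (rule normal_invI[OF Msub])
      fix g m assume g: "g \<in> carrier G" and m: "m \<in> M"
      note mc = Mc[OF m]
      have "g \<otimes> m \<otimes> inv g \<otimes> inv m \<in> N"
        using N.coset_comm_iff[OF g mc] comm[OF m g] by simp
      then have "(g \<otimes> m \<otimes> inv g \<otimes> inv m) \<otimes> m \<in> M"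
        using NM m subgroup.m_closed[OF Msub] by blast
      then show "g \<otimes> m \<otimes> inv g \<in> M" using g mc by (simp add: m_assoc)
    qed
    have Mopen: "openin T M"
      using open_subgroup_superset[OF less.prems(2) N.one_closed NM Msub] .
    let ?S = "rcosets\<^bsub>G\<lparr>carrier := M\<rparr>\<^esub> N"
    have mult: "card (rcosets N) = card (rcosets M) * card ?S"
      using card_rcosets_mult[OF N.subgroup_axioms Msub NM] .
    have pos: "card (rcosets N) > 0" using k p_prime by (simp add: prime_gt_0_nat)
    have "card ?S \<noteq> 1"
    proof
      assume "card ?S = 1"
      moreover have "N #> z \<in> ?S" "N #> \<one> \<in> ?S"
        using zM subgroup.one_closed[OF Msub] by (auto simp: RCOSETS_def)
      ultimately have "N #> z = N #> \<one>" by (metis card_1_singletonE singletonD)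
      then show False using zN N_iff[OF z(1)] by blast
    qed
    then have "card (rcosets M) < card (rcosets N)"
      using mult pos by (cases "card ?S") (auto simp: less_Suc_eq)
    then obtain n where n: "W n \<subseteq> M" using less.hyps Mnorm Mopen by blast
    have "W (Suc n) \<subseteq> N"
    proof (rule W_least)
      show "subgroup N G" by (rule N.subgroup_axioms)
      then show "closedin T N" using less.prems(2) by (rule open_subgroup_closed)
      fix x assume "x \<in> W n"
      then have x: "x \<in> M" using n by blast
      then show "x [^] p \<in> N" by (simp add: M_def)
      fix u assume u: "u \<in> carrier G"
      then show "x \<otimes> u \<otimes> inv x \<otimes> inv u \<in> N"
        using N.coset_comm_iff[OF Mc[OF x] u] comm[OF x u] by simp
    qed
    then show ?thesis by blast
  qed
qed

end

lemma ordprod_one: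
  "group G \<Longrightarrow> (\<And>k. k \<in> set ks \<Longrightarrow> f k = \<one>\<^bsub>G\<^esub>) \<Longrightarrow> ordprod G f ks = \<one>\<^bsub>G\<^esub>"
  by (induction ks) (auto simp: group.is_monoid)

lemma (in group) ordprod_single:
  assumes "distinct ks" "j \<in> set ks" "f j \<in> carrier G" "\<And>k. k \<in> set ks \<Longrightarrow> k \<noteq> j \<Longrightarrow> f k = \<one>"
  shows "ordprod G f ks = f j"
  using assms
proof (induction ks)
  case (Cons k ks)
  show ?case
  proof (cases "k = j")
    case True
    then have "ordprod G f ks = \<one>"
      using Cons.prems by (intro ordprod_one group_axioms) auto
    then show ?thesis using True Cons.prems by simp
  next
    case False
    then show ?thesis using Cons by simp
  qed
qed simp

section \<open>Trivial intersection of the filtration and injectivity of the power map\<close>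

context uniform_pro_p
begin

lemma W_two:
  "p = 2 \<Longrightarrow> x \<in> W n \<Longrightarrow> u \<in> carrier G \<Longrightarrow> x \<otimes> u \<otimes> inv x \<otimes> inv u \<in> W (Suc (Suc n))"
  using W_two_onto by blast

lemma W_pow_onto: "z \<in> W (Suc n) \<Longrightarrow> \<exists>y\<in>W n. W (Suc (Suc n)) #> y [^] p = W (Suc (Suc n)) #> z"
  using W_two_onto[of n] pow_set_iff by blast

text \<open>An open subgroup \<open>H\<close> separates \<open>y\<close> from \<open>\<one>\<close>,
  but it need not be normal. Compactness makes its normal core open, and the core contains some
  \<open>W n\<close>.\<close>

lemma Inter_W:
  assumes y: "\<And>n. y \<in> W n"
  shows "y = \<one>"
proof (rule ccontr)
  assume ne: "y \<noteq> \<one>"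
  have yc: "y \<in> carrier G" using W_carrier y by blast
  have "openin T (carrier G - {y})"
    using closedin_Hausdorff_singleton[OF Hausdorff, of y] yc by (simp add: topspace closedin_def)
  then obtain H where H: "subgroup H G" "openin T H" "H \<subseteq> carrier G - {y}"
    using small_open_subgroup[of "carrier G - {y}"] ne by auto
  note Hc = subgroup.mem_carrier[OF H(1)]
  \<comment> \<open>The normal core of \<open>H\<close>.\<close>
  define C where "C = {h \<in> carrier G. \<forall>g\<in>carrier G. g \<otimes> h \<otimes> inv g \<in> H}"
  \<comment> \<open>The pairs whose conjugate lies in \<open>H\<close> form an open set around
    \<open>carrier G \<times> {\<one>}\<close>. The tube lemma gives a single neighbourhood
    \<open>V\<close> of \<open>\<one>\<close> that works for all conjugating elements at once, so
    \<open>V\<close> lies in the core.\<close>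
  let ?P = "{z \<in> topspace (prod_topology T T). fst z \<otimes> snd z \<otimes> inv (fst z) \<in> H}"
  have "openin (prod_topology T T) ?P"
    by (rule openin_continuous_map_preimage[OF _ H(2)])
      (intro continuous_mult continuous_inv continuous_map_fst continuous_map_snd)
  moreover have "compactin T (carrier G)" using compact topspace by (simp add: compact_space_def)
  moreover have "\<one> \<in> topspace T" by (simp add: topspace)
  moreover have "carrier G \<times> {\<one>} \<subseteq> ?P"
    using subgroup.one_closed[OF H(1)] by (auto simp: topspace)
  ultimately obtain A V where AV: "openin T V" "carrier G \<subseteq> A" "\<one> \<in> V" "A \<times> V \<subseteq> ?P"
    using tube_lemma_left[of T T ?P "carrier G" \<one>] by blast
  have V: "V \<subseteq> C"
  proof
    fix v assume v: "v \<in> V"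
    then have "v \<in> carrier G" using AV(1) openin_subset topspace by blast
    moreover have "g \<otimes> v \<otimes> inv g \<in> H" if "g \<in> carrier G" for g
      using subsetD[OF AV(4), of "(g, v)"] AV(2) v that by auto
    ultimately show "v \<in> C" by (simp add: C_def)
  qed
  have Csub: "subgroup C G"
  proof
    show "C \<subseteq> carrier G" by (auto simp: C_def)
    show "\<one> \<in> C" using subgroup.one_closed[OF H(1)] by (simp add: C_def)
    fix a assume a: "a \<in> C"
    have "g \<otimes> inv a \<otimes> inv g \<in> H" if g: "g \<in> carrier G" for g
    proof -
      have "inv (g \<otimes> a \<otimes> inv g) \<in> H"
        using a g subgroup.m_inv_closed[OF H(1)] by (simp add: C_def)
      then show ?thesis using a g by (simp add: C_def inv_mult_group m_assoc)
    qed
    then show "inv a \<in> C" using a by (simp add: C_def)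
    fix b assume b: "b \<in> C"
    have "g \<otimes> (a \<otimes> b) \<otimes> inv g \<in> H" if g: "g \<in> carrier G" for g
    proof -
      have "(g \<otimes> a \<otimes> inv g) \<otimes> (g \<otimes> b \<otimes> inv g) \<in> H"
        using a b g subgroup.m_closed[OF H(1)] by (simp add: C_def)
      then show ?thesis using a b g by (simp add: C_def m_assoc mult_inv_cancel)
    qed
    then show "a \<otimes> b \<in> C" using a b by (simp add: C_def)
  qed
  have "C \<lhd> G"
  proof (rule normal_invI[OF Csub])
    fix g h assume g: "g \<in> carrier G" and h: "h \<in> C"
    have "k \<otimes> (g \<otimes> h \<otimes> inv g) \<otimes> inv k \<in> H" if k: "k \<in> carrier G" for k
    proof -
      have "(k \<otimes> g) \<otimes> h \<otimes> inv (k \<otimes> g) \<in> H" using h g k by (simp add: C_def)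
      then show ?thesis using h g k by (simp add: C_def m_assoc inv_mult_group)
    qed
    then show "g \<otimes> h \<otimes> inv g \<in> C" using g h by (simp add: C_def)
  qed
  moreover have "openin T C" using open_subgroup_superset[OF AV(1,3) V Csub] .
  ultimately obtain n where "W n \<subseteq> C" using open_normal_contains_W by blast
  then have "y \<in> C" using y by blast
  then have "\<one> \<otimes> y \<otimes> inv \<one> \<in> H" unfolding C_def by blast
  then have "y \<in> H" using yc by simp
  then show False using H(3) by blast
qed

text \<open>An element whose \<open>p\<close>-th power lies too deep can be corrected step by step so that its
  \<open>p\<close>-th power sinks ever deeper; by compactness the corrections converge to an element of
  order \<open>p\<close>.\<close>

lemma W_pow_inj:
  assumes x: "x \<in> W n" and xp: "x [^] p \<in> W (Suc (Suc n))"
  shows "x \<in> W (Suc n)"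
proof -
  note xc = W_carrier[OF x]
  define C where "C m = {y \<in> W (Suc n) #> x. y [^] p \<in> W m}" for m
  have Cc: "y \<in> carrier G" if "y \<in> C m" for y m
    using that coset_eq_preimage[OF W_subgroup xc] unfolding C_def by blast
  have closed: "closedin T (C m)" for m
  proof -
    have "C m = (W (Suc n) #> x) \<inter> {y \<in> carrier G. y [^] p \<in> W m}"
      using Cc by (auto simp: C_def)
    then show ?thesis
      by (simp add: closedin_Int coset_closed[OF W_subgroup W_closed xc]
          preimage_closed continuous_pow W_closed)
  qed
  have dec: "decseq C"
    unfolding decseq_def C_def using W_subset by blast
  have step: "C (Suc (Suc (n + i))) \<noteq> {}" for i
  proof (induction i)
    case 0
    have "x \<in> C (Suc (Suc n))" using xp rcos_self[OF xc W_subgroup] by (simp add: C_def)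
    then show ?case by auto
  next
    case (Suc i)
    let ?W = "W (Suc (Suc (Suc (n + i))))"
    interpret N: normal ?W G by (rule W_normal)
    obtain y where y: "y \<in> W (Suc n) #> x" "y [^] p \<in> W (Suc (Suc (n + i)))"
      using Suc by (auto simp: C_def)
    have yc: "y \<in> carrier G" using y coset_eq_preimage[OF W_subgroup xc] by blast
    \<comment> \<open>An approximate \<open>p\<close>-th root of \<open>y [^] p\<close>. Dividing
      \<open>y\<close> by it cancels the leading term of the power, while \<open>v\<close> is deep
      enough for the coset of \<open>x\<close> to be kept.\<close>
    obtain v where v: "v \<in> W (Suc (n + i))" "?W #> v [^] p = ?W #> (y [^] p)"
      using W_pow_onto[OF y(2)] by blast
    note vc = W_carrier[OF v(1)]
    have iv: "inv v \<in> W (Suc (n + i))" using subgroup.m_inv_closed[OF W_subgroup v(1)] .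
    have "y \<otimes> inv v \<otimes> inv y \<otimes> inv (inv v) \<in> ?W" if "p = 2"
      using W_two[OF that iv yc] N.coset_comm_iff[of y "inv v"] N.coset_comm_iff[of "inv v" y] yc vc
      by simp
    then have "?W #> ((y \<otimes> inv v) [^] p) = ?W #> (y [^] p \<otimes> inv v [^] p)"
      using W_pow_mult[OF yc iv] by blast
    also have "\<dots> = ?W #> (v [^] p \<otimes> inv v [^] p)"
      using yc vc v(2) by (intro N.coset_mult_cong[OF _ _ _ _ _ refl]) auto
    also have "v [^] p \<otimes> inv v [^] p = \<one>" using vc by (simp add: nat_pow_inv)
    finally have "(y \<otimes> inv v) [^] p \<in> ?W"
      using W_coset_eq_iff[of "(y \<otimes> inv v) [^] p" \<one>] yc vc by simp
    moreover have "y \<otimes> inv v \<in> W (Suc n) #> x"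
    proof -
      interpret M: normal "W (Suc n)" G by (rule W_normal)
      have "inv v \<in> W (Suc n)" using iv W_subset[of "Suc n" "Suc (n + i)"] by auto
      moreover have "y \<otimes> inv x \<in> W (Suc n)" using y(1) coset_eq_preimage[OF W_subgroup xc] by blast
      ultimately have "(y \<otimes> inv v \<otimes> inv y) \<otimes> (y \<otimes> inv x) \<in> W (Suc n)"
        using M.inv_op_closed2[OF yc] M.m_closed by blast
      then have "y \<otimes> inv v \<otimes> inv x \<in> W (Suc n)"
        using yc vc xc by (simp add: m_assoc mult_inv_cancel)
      then show ?thesis using coset_eq_preimage[OF W_subgroup xc] yc vc by simp
    qed
    ultimately have "y \<otimes> inv v \<in> C (Suc (Suc (n + Suc i)))" by (simp add: C_def)
    then show ?case by blast
  qed
  have ne: "C m \<noteq> {}" for m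
  proof -
    have "C (Suc (Suc (n + m))) \<subseteq> C m" using dec by (simp add: decseq_def)
    then show ?thesis using step[of m] by blast
  qed
  \<comment> \<open>The common point has a \<open>p\<close>-th power in every \<open>W m\<close>, so
    it has order dividing \<open>p\<close> and is trivial. It still lies in
    \<open>W (Suc n) #> x\<close>, which is therefore the trivial coset.\<close>
  obtain y where y: "\<And>m. y \<in> C m"
    using compact_space_imp_nest[OF compact closed ne dec] by blast
  have "y [^] p = \<one>" using y Inter_W[of "y [^] p"] by (simp add: C_def)
  then have "y = \<one>" using torsion[OF Cc[OF y]] p_prime prime_gt_0_nat by blast
  then have "\<one> \<otimes> inv x \<in> W (Suc n)"
    using y[of 0] coset_eq_preimage[OF W_subgroup xc] by (simp add: C_def)
  then have "inv x \<in> W (Suc n)" using xc by simp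
  then have "inv (inv x) \<in> W (Suc n)" by (rule subgroup.m_inv_closed[OF W_subgroup])
  then show ?thesis using xc by simp
qed

sublocale uniform_filtration G p W
  by unfold_locales (use W_two W_pow_onto W_pow_inj in auto)

end

section \<open>Minimal generating systems\<close>

locale uniform_gens = uniform_pro_p +
  fixes x :: "nat \<Rightarrow> 'a" and ks :: "nat list"
  assumes ks_distinct: "distinct ks"
    and gens: "topologically_generates G T (x ` set ks)"
    and minimal: "I \<subset> set ks \<Longrightarrow> \<not> topologically_generates G T (x ` I)"
begin

lemma x_carrier: "k \<in> set ks \<Longrightarrow> x k \<in> carrier G"
  using gens by (auto simp: topologically_generates_def)

abbreviation expo :: "(nat \<Rightarrow> nat) \<Rightarrow> 'a" where
  "expo f \<equiv> ordprod G (\<lambda>k. x k [^] f k) ks"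

lemma expo_carrier: "expo f \<in> carrier G"
  using x_carrier by (intro ordprod_closed) auto

lemma pow_p_W1: "u \<in> carrier G \<Longrightarrow> u [^] p \<in> W (Suc 0)"
  using W_pow[of u 0] by (simp add: W_0)

lemma expo_add: "W (Suc 0) #> expo (\<lambda>k. f k + g k) = W (Suc 0) #> (expo f \<otimes> expo g)"
proof -
  have "expo (\<lambda>k. f k + g k) = ordprod G (\<lambda>k. x k [^] f k \<otimes> x k [^] g k) ks"
    using x_carrier by (intro ordprod_cong) (simp add: nat_pow_mult)
  then show ?thesis
    using W_ordprod_mult[of ks "\<lambda>k. x k [^] f k" "\<lambda>k. x k [^] g k" 0] x_carrier by (simp add: W_0)
qed

lemma expo_mod: "W (Suc 0) #> expo f = W (Suc 0) #> expo (\<lambda>k. f k mod p)"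
  by (rule normal.coset_ordprod_cong[OF W_normal])
    (use x_carrier pow_p_W1 normal.coset_pow_mod[OF W_normal] in auto)

lemma expo_zero: "expo (\<lambda>_. 0) = \<one>"
  by (intro ordprod_one group_axioms) simp

text \<open>The elements congruent to some \<open>expo f\<close> form a subgroup containing the
  generators. It is a finite union of closed cosets, so it is closed and must be everything.\<close>

lemma base_span:
  assumes "u \<in> carrier G"
  shows "\<exists>f. (\<forall>k\<in>set ks. f k < p) \<and> W (Suc 0) #> u = W (Suc 0) #> expo f"
proof -
  interpret N: normal "W (Suc 0)" G by (rule W_normal)
  define S where "S = {u \<in> carrier G. \<exists>f. W (Suc 0) #> u = W (Suc 0) #> expo f}"
  have S_reduced: "\<exists>f\<in>PiE (set ks) (\<lambda>_. {..<p}). W (Suc 0) #> u = W (Suc 0) #> expo f"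
    if u: "u \<in> S" for u
  proof -
    obtain f where f: "W (Suc 0) #> u = W (Suc 0) #> expo f" using u by (auto simp: S_def)
    let ?g = "restrict (\<lambda>k. f k mod p) (set ks)"
    have "expo ?g = expo (\<lambda>k. f k mod p)" by (intro ordprod_cong) simp
    then have "W (Suc 0) #> u = W (Suc 0) #> expo ?g" using f expo_mod[of f] by simp
    moreover have "?g \<in> PiE (set ks) (\<lambda>_. {..<p})" using p_prime by (auto simp: prime_gt_0_nat)
    ultimately show ?thesis by blast
  qed
  have S_sub: "subgroup S G"
  proof
    show "S \<subseteq> carrier G" by (auto simp: S_def)
    have "W (Suc 0) #> \<one> = W (Suc 0) #> expo (\<lambda>_. 0)" by (simp only: expo_zero)
    then show "\<one> \<in> S" unfolding S_def by (intro CollectI conjI exI[of _ "\<lambda>_. 0"]) auto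
    fix a assume "a \<in> S"
    then obtain f where a: "a \<in> carrier G" and f: "W (Suc 0) #> a = W (Suc 0) #> expo f"
      by (auto simp: S_def)
    \<comment> \<open>Modulo \<open>p\<close> the factor \<open>p - 1\<close> is minus one, so this
      is the exponent vector of the inverse without leaving the natural numbers.\<close>
    let ?g = "\<lambda>k. (p - 1) * f k"
    have "W (Suc 0) #> (a \<otimes> expo ?g) = W (Suc 0) #> (expo f \<otimes> expo ?g)"
      using a f expo_carrier by (intro N.coset_mult_cong) auto
    also have "\<dots> = W (Suc 0) #> expo (\<lambda>k. f k + ?g k)" by (simp only: expo_add)
    also have "(\<lambda>k. f k + ?g k) = (\<lambda>k. p * f k)"
      using prime_gt_0_nat[OF p_prime] by (cases p) simp_all
    also have "W (Suc 0) #> expo (\<lambda>k. p * f k) = W (Suc 0) #> \<one>"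
      using expo_mod[of "\<lambda>k. p * f k"] expo_zero by simp
    finally have "W (Suc 0) #> (a \<otimes> expo ?g) = W (Suc 0) #> \<one>" .
    then have "W (Suc 0) #> (inv a \<otimes> (a \<otimes> expo ?g)) = W (Suc 0) #> (inv a \<otimes> \<one>)"
      using a expo_carrier by (intro N.coset_mult_cong[OF _ _ _ _ refl]) auto
    then have "W (Suc 0) #> inv a = W (Suc 0) #> expo ?g"
      using a expo_carrier by (simp add: mult_inv_cancel)
    then show "inv a \<in> S" using a unfolding S_def by (intro CollectI conjI exI[of _ ?g]) auto
    fix b assume "b \<in> S"
    then obtain g where b: "b \<in> carrier G" and g: "W (Suc 0) #> b = W (Suc 0) #> expo g"
      by (auto simp: S_def)
    have "W (Suc 0) #> (a \<otimes> b) = W (Suc 0) #> (expo f \<otimes> expo g)"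
      using a b f g expo_carrier by (intro N.coset_mult_cong) auto
    then have "W (Suc 0) #> (a \<otimes> b) = W (Suc 0) #> expo (\<lambda>k. f k + g k)"
      by (simp only: expo_add)
    then show "a \<otimes> b \<in> S"
      using a b unfolding S_def by (intro CollectI conjI exI[of _ "\<lambda>k. f k + g k"]) auto
  qed
  have "S = \<Union>((\<lambda>f. W (Suc 0) #> expo f) ` PiE (set ks) (\<lambda>_. {..<p}))"
  proof
    show "S \<subseteq> \<Union>((\<lambda>f. W (Suc 0) #> expo f) ` PiE (set ks) (\<lambda>_. {..<p}))"
    proof
      fix u assume u: "u \<in> S"
      then have "u \<in> W (Suc 0) #> u" by (intro rcos_self W_subgroup) (simp add: S_def)
      then show "u \<in> \<Union>((\<lambda>f. W (Suc 0) #> expo f) ` PiE (set ks) (\<lambda>_. {..<p}))"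
        using S_reduced[OF u] by blast
    qed
    have "u \<in> S" if "u \<in> W (Suc 0) #> expo f" for u f
    proof -
      have "u \<in> carrier G" using that coset_eq_preimage[OF W_subgroup expo_carrier] by blast
      then show ?thesis
        using repr_independence[OF that expo_carrier W_subgroup] unfolding S_def by blast
    qed
    then show "\<Union>((\<lambda>f. W (Suc 0) #> expo f) ` PiE (set ks) (\<lambda>_. {..<p})) \<subseteq> S" by blast
  qed
  moreover have "closedin T (\<Union>((\<lambda>f. W (Suc 0) #> expo f) ` PiE (set ks) (\<lambda>_. {..<p})))"
    by (intro closedin_Union finite_imageI finite_PiE)
      (auto intro!: coset_closed W_subgroup W_closed expo_carrier)
  ultimately have S_closed: "closedin T S" by (simp only:)
  have "x j \<in> S" if j: "j \<in> set ks" for j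
  proof -
    let ?f = "\<lambda>k. if k = j then 1 else (0::nat)"
    have "expo ?f = x j [^] ?f j"
      using ks_distinct j x_carrier[OF j] by (intro ordprod_single) auto
    then have "W (Suc 0) #> x j = W (Suc 0) #> expo ?f" using x_carrier[OF j] by simp
    then show ?thesis
      using x_carrier[OF j] unfolding S_def by (intro CollectI conjI exI[of _ ?f]) auto
  qed
  then have "T closure_of generate G (x ` set ks) \<subseteq> S"
    by (intro generate_closure_subset S_sub S_closed) auto
  then have "u \<in> S" using gens assms by (auto simp: topologically_generates_def)
  then show ?thesis using S_reduced by (fastforce simp: PiE_iff)
qed

text \<open>The Frattini argument: taking \<open>p\<close>-th powers carries approximation by \<open>D\<close> from each layer to
  the next.\<close>

lemma closed_subgroup_eq_carrier:
  assumes D: "subgroup D G" "closedin T D"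
    and base: "\<And>u. u \<in> carrier G \<Longrightarrow> \<exists>t\<in>D. W (Suc 0) #> u = W (Suc 0) #> t"
  shows "D = carrier G"
proof
  note Dc = subgroup.mem_carrier[OF D(1)]
  show "D \<subseteq> carrier G" using subgroup.subset[OF D(1)] .
  have layer: "\<exists>t\<in>D. t \<in> W n \<and> W (Suc n) #> y = W (Suc n) #> t" if "y \<in> W n" for y n
    using that
  proof (induction n arbitrary: y)
    case 0
    then show ?case using base Dc W_0 by blast
  next
    case (Suc n)
    obtain z where z: "z \<in> W n" "W (Suc (Suc n)) #> z [^] p = W (Suc (Suc n)) #> y"
      using W_pow_onto[OF Suc.prems] by blast
    obtain t where t: "t \<in> D" "t \<in> W n" "W (Suc n) #> z = W (Suc n) #> t"
      using Suc.IH[OF z(1)] by blast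
    have "t [^] i \<in> D" for i :: nat
      using t(1) subgroup.one_closed[OF D(1)] subgroup.m_closed[OF D(1)] by (induction i) auto
    then have "t [^] p \<in> D" .
    moreover have "W (Suc (Suc n)) #> y = W (Suc (Suc n)) #> (t [^] p)"
      using W_pow_cong[OF z(1) t(2,3)] z(2) by simp
    ultimately show ?case using W_pow[OF t(2)] by blast
  qed
  have approx: "\<exists>t\<in>D. W n #> u = W n #> t" if u: "u \<in> carrier G" for u n
  proof (induction n)
    case 0
    have "W 0 #> u = W 0 #> \<one>" using u W_0 by (intro W_coset_one) simp
    then show ?case using subgroup.one_closed[OF D(1)] by blast
  next
    case (Suc n)
    interpret N: normal "W n" G by (rule W_normal)
    interpret N': normal "W (Suc n)" G by (rule W_normal)
    obtain t where t: "t \<in> D" "W n #> u = W n #> t" using Suc by blast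
    note tc = Dc[OF t(1)]
    have "W n #> (inv t \<otimes> u) = W n #> (inv t \<otimes> t)"
      using t(2) tc u by (intro N.coset_mult_cong[OF _ _ _ _ refl]) auto
    then have "inv t \<otimes> u \<in> W n"
      using W_coset_eq_iff[of "inv t \<otimes> u" "inv t \<otimes> t" n] tc u by simp
    then obtain s where s: "s \<in> D" "W (Suc n) #> (inv t \<otimes> u) = W (Suc n) #> s"
      using layer by blast
    have "W (Suc n) #> (t \<otimes> (inv t \<otimes> u)) = W (Suc n) #> (t \<otimes> s)"
      using s(2) tc u Dc[OF s(1)] by (intro N'.coset_mult_cong[OF _ _ _ _ refl]) auto
    then have "W (Suc n) #> u = W (Suc n) #> (t \<otimes> s)" using tc u by (simp add: mult_inv_cancel)
    then show ?case using subgroup.m_closed[OF D(1) t(1) s(1)] by blast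
  qed
  show "carrier G \<subseteq> D"
  proof
    fix u assume u: "u \<in> carrier G"
    \<comment> \<open>The approximations of \<open>u\<close> from \<open>D\<close> at each depth. A
      common point differs from \<open>u\<close> by an element of every \<open>W n\<close>, hence
      equals \<open>u\<close>.\<close>
    define C where "C n = D \<inter> (W n #> u)" for n
    have mem: "t \<in> W n #> u \<longleftrightarrow> t \<otimes> inv u \<in> W n" if "t \<in> carrier G" for t n
      using coset_eq_preimage[OF W_subgroup u] that by simp
    have "C n \<noteq> {}" for n
    proof -
      obtain t where t: "t \<in> D" "W n #> u = W n #> t" using approx[OF u] by blast
      then have "t \<in> W n #> u" using rcos_self[OF Dc[OF t(1)] W_subgroup] by simp
      then show ?thesis using t by (auto simp: C_def)
    qed
    moreover have "closedin T (C n)" for n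
      unfolding C_def by (intro closedin_Int D(2) coset_closed W_subgroup W_closed u)
    moreover have "decseq C"
      unfolding decseq_def C_def using mem Dc W_subset by blast
    ultimately obtain t where t: "\<And>n. t \<in> C n"
      using compact_space_imp_nest[OF compact, of C] by blast
    have tD: "t \<in> D" using t by (simp add: C_def)
    then have "t \<otimes> inv u \<in> W n" for n using t[of n] mem[OF Dc[OF tD]] by (simp add: C_def)
    then have "t \<otimes> inv u = \<one>" by (rule Inter_W)
    then have "t = u" using Dc[OF tD] u by (metis inv_equality inv_inv inv_closed)
    then show "u \<in> D" using tD by simp
  qed
qed

text \<open>Suppose the exponents at \<open>j\<close> differ. Modulo the other generators and
  \<open>W (Suc 0)\<close> the element \<open>x j\<close> then becomes trivial, so these generate
  together with \<open>W (Suc 0)\<close>; by the Frattini argument the others generate alone,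
  against minimality.\<close>

lemma base_indep:
  assumes f: "\<And>k. k \<in> set ks \<Longrightarrow> f k < p" and g: "\<And>k. k \<in> set ks \<Longrightarrow> g k < p"
    and eq: "W (Suc 0) #> expo f = W (Suc 0) #> expo g" and j: "j \<in> set ks"
  shows "f j = g j"
proof (rule ccontr)
  assume ne: "f j \<noteq> g j"
  interpret N: normal "W (Suc 0)" G by (rule W_normal)
  define I where "I = set ks - {j}"
  have xI: "x ` I \<subseteq> carrier G" using x_carrier by (auto simp: I_def)
  define D where "D = T closure_of generate G (x ` I)"
  have D: "subgroup D G" "closedin T D"
    using closure_subgroup[OF generate_is_subgroup[OF xI]] by (simp_all add: D_def)
  note Dc = subgroup.mem_carrier[OF D(1)]
  \<comment> \<open>A product of two sets suffices, \<open>W (Suc 0)\<close> being normal.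
    \<open>V\<close> is closed by compactness, and normal because it contains all
    commutators.\<close>
  define V where "V = {w \<otimes> t | t w. t \<in> D \<and> w \<in> W (Suc 0)}"
  have V_eq: "V = W (Suc 0) <#> D" by (auto simp: V_def set_mult_def)
  have V_closed: "closedin T V"
    using closedin_mult_image[OF compact Hausdorff D(2) W_closed continuous_id] by (simp add: V_def)
  have V_sub: "subgroup V G"
    unfolding V_eq by (rule mult_norm_subgroup[OF W_normal D(1)])
  have DV: "D \<subseteq> V"
  proof
    fix t assume t: "t \<in> D"
    have "\<one> \<otimes> t \<in> V" using t N.one_closed unfolding V_def by blast
    then show "t \<in> V" using Dc[OF t] by simp
  qed
  have WV: "W (Suc 0) \<subseteq> V"
  proof
    fix w assume w: "w \<in> W (Suc 0)"
    have "w \<otimes> \<one> \<in> V" using w subgroup.one_closed[OF D(1)] unfolding V_def by blast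
    then show "w \<in> V" using W_carrier[OF w] by simp
  qed
  have V_normal: "V \<lhd> G"
  proof (rule normal_invI[OF V_sub])
    fix a v assume a: "a \<in> carrier G" and v: "v \<in> V"
    have vc: "v \<in> carrier G" using subgroup.mem_carrier[OF V_sub v] .
    have "a \<otimes> v \<otimes> inv a \<otimes> inv v \<in> W (Suc 0)" using W_comm[of a 0 v] a vc by (simp add: W_0)
    then have "(a \<otimes> v \<otimes> inv a \<otimes> inv v) \<otimes> v \<in> V"
      using WV v subgroup.m_closed[OF V_sub] by blast
    then show "a \<otimes> v \<otimes> inv a \<in> V" using a vc by (simp add: m_assoc)
  qed
  interpret V: normal V G by (rule V_normal)
  have xI_V: "x k \<in> V" if "k \<in> I" for k
  proof -
    have "x k \<in> generate G (x ` I)" using that by (intro generate.incl) blast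
    then have "x k \<in> D"
      unfolding D_def using closure_subset[OF generate_incl[OF xI]] by blast
    then show ?thesis using DV by blast
  qed
  have reduce: "V #> expo f = V #> (x j [^] f j)" for f
  proof -
    let ?h = "\<lambda>k. if k = j then x j [^] f j else \<one>"
    have "V #> expo f = V #> ordprod G ?h ks"
    proof (rule V.coset_ordprod_cong)
      fix k assume k: "k \<in> set ks"
      have "x k [^] i \<in> V" if "k \<noteq> j" for i :: nat
        using xI_V[of k] that k V.m_closed V.one_closed by (induction i) (auto simp: I_def)
      then show "V #> x k [^] f k = V #> ?h k"
        using x_carrier[OF k] by (subst V.coset_eq_iff[OF group_axioms]) auto
    qed (use x_carrier j in auto)
    also have "ordprod G ?h ks = ?h j"
      using ks_distinct j x_carrier[OF j] by (intro ordprod_single) auto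
    finally show ?thesis by simp
  qed
  have "V #> expo f = V #> expo g"
    using subgroup.coset_eq_subset[OF W_subgroup group_axioms V_sub WV expo_carrier expo_carrier eq] .
  then have pow_eq: "V #> (x j [^] f j) = V #> (x j [^] g j)" by (simp only: reduce)
  note xc = x_carrier[OF j]
  interpret Q: group "G Mod V" by (rule V.factorgroup_is_group)
  let ?X = "V #> x j"
  have X: "?X \<in> carrier (G Mod V)" using xc by (auto simp: carrier_FactGroup)
  have "?X [^]\<^bsub>G Mod V\<^esub> f j = ?X [^]\<^bsub>G Mod V\<^esub> g j"
    using pow_eq by (simp add: V.FactGroup_pow[OF xc])
  then have "int (Q.ord ?X) dvd int (f j) - int (g j)"
    using Q.int_pow_eq[OF X, of "int (f j)" "int (g j)"]
    by (simp add: int_pow_int dvd_diff_commute)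
  moreover have "Q.ord ?X dvd p"
  proof -
    have "x j [^] p \<in> V" using pow_p_W1[OF xc] WV by blast
    then have "?X [^]\<^bsub>G Mod V\<^esub> p = \<one>\<^bsub>G Mod V\<^esub>"
      using V.FactGroup_pow[OF xc, of p] coset_join2[OF _ V_sub] xc by simp
    then show ?thesis using Q.pow_eq_id[OF X] by blast
  qed
  then have "Q.ord ?X = 1 \<or> Q.ord ?X = p" using p_prime by (simp add: prime_nat_iff)
  \<comment> \<open>Distinct numbers below \<open>p\<close> differ by less than \<open>p\<close>,
    which excludes order \<open>p\<close> and leaves order 1.\<close>
  moreover have "\<not> int p dvd int (f j) - int (g j)"
  proof
    assume "int p dvd int (f j) - int (g j)"
    then have "int p \<le> \<bar>int (f j) - int (g j)\<bar>" using ne dvd_imp_le_int[of "int (f j) - int (g j)" "int p"] by simp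
    then show False using f[OF j] g[OF j] by linarith
  qed
  ultimately have "Q.ord ?X = 1" by metis
  then have "?X = \<one>\<^bsub>G Mod V\<^esub>" using Q.ord_eq_1[OF X] by blast
  then have "x j \<in> V" using rcos_self[OF xc V_sub] by simp
  then have "x ` set ks \<subseteq> V" using xI_V by (auto simp: I_def)
  then have "T closure_of generate G (x ` set ks) \<subseteq> V"
    by (intro generate_closure_subset V_sub V_closed)
  then have V_all: "carrier G \<subseteq> V" using gens by (simp add: topologically_generates_def)
  have "D = carrier G"
  proof (rule closed_subgroup_eq_carrier[OF D])
    fix u assume "u \<in> carrier G"
    then obtain t w where tw: "t \<in> D" "w \<in> W (Suc 0)" "u = w \<otimes> t" using V_all by (auto simp: V_def)
    have "u \<otimes> inv t = w" using tw Dc W_carrier by (simp add: m_assoc)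
    then have "W (Suc 0) #> u = W (Suc 0) #> t"
      using tw \<open>u \<in> carrier G\<close> Dc W_coset_eq_iff by simp
    then show "\<exists>t\<in>D. W (Suc 0) #> u = W (Suc 0) #> t" using tw by blast
  qed
  then have "topologically_generates G T (x ` I)"
    using xI by (simp add: topologically_generates_def D_def)
  moreover have "I \<subset> set ks" using j by (auto simp: I_def)
  ultimately show False using minimal by blast
qed

sublocale uniform_coordinates G p W x ks
  by unfold_locales (use ks_distinct x_carrier base_span base_indep in auto)

section \<open>Two-sided bounds for the index of an open normal subgroup\<close>

lemma open_normal_index_le:
  assumes "N \<lhd> G" "openin T N" "\<And>k. k \<in> set ks \<Longrightarrow> x k [^] (p ^ m k) \<in> N"
  shows "card (rcosets N) \<le> p ^ (\<Sum>k\<in>set ks. m k)"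
proof -
  obtain n where "W n \<subseteq> N" using open_normal_contains_W assms by blast
  then show ?thesis using card_rcosets_upper assms by blast
qed

text \<open>The \<open>q\<close> cosets of \<open>y [^] g\<close> cover the cyclic group generated
  by \<open>y\<close>. Their union is closed, so it covers the closure as well, and elements of a
  procyclic group behave like ordinary powers modulo \<open>W n\<close>.\<close>

lemma procyclic_coset:
  assumes y: "y \<in> carrier G" and q: "q > 0" "y [^] (q::nat) \<in> W n"
    and c: "c \<in> procyclic_subgroup G T y"
  shows "\<exists>g<q. W n #> c = W n #> (y [^] g)"
proof -
  let ?C = "\<Union>((\<lambda>g. W n #> (y [^] g)) ` {..<q})"
  have "closedin T ?C"
    using y by (intro closedin_Union) (auto intro!: coset_closed W_subgroup W_closed)
  moreover have "generate G {y} \<subseteq> ?C"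
  proof
    fix z assume "z \<in> generate G {y}"
    then obtain k :: int where k: "z = y [^] k" using generate_pow[OF y] by blast
    \<comment> \<open>Elements of the generated group are integer powers; reduction modulo
      \<open>q\<close> gives a natural exponent, the rest being a power of
      \<open>y [^] q\<close>.\<close>
    let ?g = "nat (k mod int q)"
    have g: "int ?g = k mod int q" "?g < q" using q(1) by (auto simp: nat_less_iff)
    have "y [^] k = y [^] (int q * (k div int q) + k mod int q)" by simp
    also have "\<dots> = (y [^] int q) [^] (k div int q) \<otimes> y [^] (k mod int q)"
      using y by (simp only: int_pow_mult int_pow_pow)
    also have "\<dots> = (y [^] q) [^] (k div int q) \<otimes> y [^] ?g"
      using int_pow_int[of G y "?g"] int_pow_int[of G y q] unfolding g(1) by (simp only:)
    finally have "z = (y [^] q) [^] (k div int q) \<otimes> y [^] ?g" using k by simp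
    moreover have "(y [^] q) [^] (k div int q) \<in> W n"
      using subgroup_int_pow_closed[OF W_subgroup q(2)] .
    ultimately have "z \<in> W n #> (y [^] ?g)"
      using rcosI W_sub_carrier y by simp
    then show "z \<in> ?C" using g by blast
  qed
  ultimately have "procyclic_subgroup G T y \<subseteq> ?C"
    unfolding procyclic_subgroup_def by (intro closure_of_minimal)
  then obtain g where g: "g < q" "c \<in> W n #> (y [^] g)" using c by blast
  then have "W n #> (y [^] g) = W n #> c" using y by (intro repr_independence W_subgroup) auto
  then show ?thesis using g by auto
qed

lemma foldr_procyclic:
  assumes "distinct l" "h \<in> foldr (\<lambda>k S. procyclic_subgroup G T (y k) <#> S) l {\<one>}"
  shows "\<exists>c. (\<forall>k\<in>set l. c k \<in> procyclic_subgroup G T (y k)) \<and> h = ordprod G c l"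
  using assms
proof (induction l arbitrary: h)
  case (Cons k l)
  then obtain a s where as: "a \<in> procyclic_subgroup G T (y k)" "h = a \<otimes> s"
      "s \<in> foldr (\<lambda>k S. procyclic_subgroup G T (y k) <#> S) l {\<one>}"
    by (auto simp: set_mult_def)
  then obtain c where c: "\<forall>k\<in>set l. c k \<in> procyclic_subgroup G T (y k)" "s = ordprod G c l"
    using Cons by auto
  have "ordprod G (c(k := a)) l = ordprod G c l"
    using Cons.prems(1) by (intro ordprod_cong) auto
  then have "h = ordprod G (c(k := a)) (k # l)" using as(2) c(2) by simp
  moreover have "\<forall>i\<in>set (k # l). (c(k := a)) i \<in> procyclic_subgroup G T (y i)"
    using as(1) c(1) by simp
  ultimately show ?case by blast
qed simp

lemma open_normal_index_ge:
  assumes H: "H \<lhd> G" "openin T H"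
    and sub: "H \<subseteq> foldr (\<lambda>k S. procyclic_subgroup G T (x k [^] (p ^ m k)) <#> S) ks {\<one>}"
  shows "p ^ (\<Sum>k\<in>set ks. m k) \<le> card (rcosets H)"
proof -
  obtain n0 where n0: "W n0 \<subseteq> H" using open_normal_contains_W[OF H] by blast
  \<comment> \<open>Deep enough for \<open>W n\<close> to lie in \<open>H\<close>; adding the sum is
    a simple way to exceed every \<open>m k\<close>.\<close>
  define n where "n = n0 + (\<Sum>k\<in>set ks. m k)"
  have mn: "m k \<le> n" if "k \<in> set ks" for k
    using member_le_sum[OF that, of m] by (simp add: n_def)
  have n: "W n \<subseteq> H" using n0 W_subset[of n0 n] by (auto simp: n_def)
  show ?thesis
  proof (rule card_rcosets_lower[OF normal_imp_subgroup[OF H(1)] n mn])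
    fix h assume h: "h \<in> H"
    obtain c where c: "\<forall>k\<in>set ks. c k \<in> procyclic_subgroup G T (x k [^] (p ^ m k))"
        "h = ordprod G c ks"
      using foldr_procyclic[OF ks_distinct subsetD[OF sub h]] by blast
    have "\<exists>g<p ^ (n - m k). W n #> c k = W n #> ((x k [^] (p ^ m k)) [^] g)" if k: "k \<in> set ks" for k
    proof (rule procyclic_coset)
      have "p ^ m k * p ^ (n - m k) = p ^ n * 1" using mn[OF k] by (simp flip: power_add)
      then show "(x k [^] (p ^ m k)) [^] (p ^ (n - m k)) \<in> W n"
        using x_pow_mem[OF k, of n 1] x_carrier[OF k] by (simp add: nat_pow_pow)
    qed (use k x_carrier c p_prime in \<open>auto simp: prime_gt_0_nat\<close>)
    then obtain g where g: "\<And>k. k \<in> set ks \<Longrightarrow> g k < p ^ (n - m k)"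
        "\<And>k. k \<in> set ks \<Longrightarrow> W n #> c k = W n #> ((x k [^] (p ^ m k)) [^] g k)"
      by metis
    have cc: "c k \<in> carrier G" if "k \<in> set ks" for k
      using c that closure_carrier unfolding procyclic_subgroup_def by blast
    have "W n #> h = W n #> coord (\<lambda>k. p ^ m k * g k)"
      unfolding c(2) coord_def
      by (rule normal.coset_ordprod_cong[OF W_normal])
        (use cc x_carrier g(2) in \<open>auto simp: nat_pow_pow\<close>)
    then show "\<exists>g. (\<forall>k\<in>set ks. g k < p ^ (n - m k)) \<and> W n #> h = W n #> coord (\<lambda>k. p ^ m k * g k)"
      using g(1) by blast
  qed
qed

end

section \<open>Indices of products of procyclic subgroups\<close>

lemma foldr_set_mult_mem:
  assumes "\<And>k. k \<in> set l \<Longrightarrow> c k \<in> A k"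
  shows "ordprod G c l \<in> foldr (\<lambda>k S. A k <#>\<^bsub>G\<^esub> S) l {\<one>\<^bsub>G\<^esub>}"
  using assms by (induction l) (auto simp: set_mult_def)

context topgroup
begin

lemma mem_procyclic_subgroup: "y \<in> carrier G \<Longrightarrow> y \<in> procyclic_subgroup G T y"
  unfolding procyclic_subgroup_def
  using closure_subset[OF generate_incl, of "{y}"] generate.incl[of y "{y}" G] by blast

lemma procyclic_subgroup_is_subgroup:
  "y \<in> carrier G \<Longrightarrow> subgroup (procyclic_subgroup G T y) G"
  unfolding procyclic_subgroup_def by (intro closure_subgroup generate_is_subgroup) simp

lemma mem_procyclic_product:
  assumes "\<And>k. k \<in> {1..d} \<Longrightarrow> y k \<in> carrier G" "j \<in> {1..d}"
  shows "y j \<in> procyclic_product G T d y"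
proof -
  let ?c = "\<lambda>k. if k = j then y j else \<one>"
  have "?c k \<in> procyclic_subgroup G T (y k)" if "k \<in> set [1..<Suc d]" for k
    using that assms(1)[of k] mem_procyclic_subgroup
      subgroup.one_closed[OF procyclic_subgroup_is_subgroup] by (auto simp: less_Suc_eq_le)
  then have "ordprod G ?c [1..<Suc d] \<in> procyclic_product G T d y"
    unfolding procyclic_product_def by (rule foldr_set_mult_mem)
  moreover have "ordprod G ?c [1..<Suc d] = ?c j"
    using assms(1)[OF assms(2)] assms(2) by (intro ordprod_single) auto
  ultimately show ?thesis by simp
qed

lemma procyclic_subgroup_subset:
  assumes "subgroup U G" "closedin T U" "y \<in> U"
  shows "procyclic_subgroup G T y \<subseteq> U"
  unfolding procyclic_subgroup_def using assms by (intro generate_closure_subset) auto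

text \<open>The products are formed in \<open>G\<close>, whereas the coordinates live in
  \<open>U\<close> as a group in its own right. Both readings agree because \<open>U\<close> is
  closed.\<close>

lemma procyclic_subgroup_consistent:
  assumes U: "subgroup U G" "closedin T U" and y: "y \<in> U"
  shows "procyclic_subgroup (G\<lparr>carrier := U\<rparr>) (subtopology T U) y = procyclic_subgroup G T y"
proof -
  have "generate G {y} \<subseteq> U" using U(1) y by (intro generate_subgroup_incl) auto
  then have "procyclic_subgroup (G\<lparr>carrier := U\<rparr>) (subtopology T U) y =
      U \<inter> procyclic_subgroup G T y"
    unfolding procyclic_subgroup_def using generate_consistent[of "{y}" U] U(1) y
    by (simp add: closure_of_subtopology Int_absorb1)
  then show ?thesis using procyclic_subgroup_subset[OF U y] by blast
qed

lemma procyclic_product_subset: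
  assumes U: "subgroup U G" "closedin T U" and y: "\<And>k. k \<in> {1..d} \<Longrightarrow> y k \<in> U"
  shows "procyclic_product G T d y \<subseteq> U"
proof -
  have "foldr (\<lambda>k S. procyclic_subgroup G T (y k) <#> S) l {\<one>} \<subseteq> U"
    if "\<And>k. k \<in> set l \<Longrightarrow> y k \<in> U" for l
    using that
  proof (induction l)
    case Nil
    then show ?case using subgroup.one_closed[OF U(1)] by simp
  next
    case (Cons k l)
    have "procyclic_subgroup G T (y k) \<subseteq> U"
      using Cons.prems by (intro procyclic_subgroup_subset U) simp
    moreover have "foldr (\<lambda>k S. procyclic_subgroup G T (y k) <#> S) l {\<one>} \<subseteq> U"
      using Cons by simp
    ultimately show ?case
      using subgroup.m_closed[OF U(1)] by (fastforce simp: set_mult_def)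
  qed
  from this[of "[1..<Suc d]"] show ?thesis
    unfolding procyclic_product_def using y by (simp del: upt_Suc)
qed

lemma procyclic_product_consistent:
  assumes U: "subgroup U G" "closedin T U" and y: "\<And>k. k \<in> {1..d} \<Longrightarrow> y k \<in> U"
  shows "procyclic_product (G\<lparr>carrier := U\<rparr>) (subtopology T U) d y = procyclic_product G T d y"
proof -
  have "foldr (\<lambda>k S. procyclic_subgroup (G\<lparr>carrier := U\<rparr>) (subtopology T U) (y k)
        <#>\<^bsub>G\<lparr>carrier := U\<rparr>\<^esub> S) l {\<one>\<^bsub>G\<lparr>carrier := U\<rparr>\<^esub>} =
      foldr (\<lambda>k S. procyclic_subgroup G T (y k) <#> S) l {\<one>}"
    if "\<And>k. k \<in> set l \<Longrightarrow> y k \<in> U" for l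
    using that by (induction l) (simp_all add: procyclic_subgroup_consistent[OF U])
  then show ?thesis unfolding procyclic_product_def by this (use y in auto)
qed

text \<open>Containing the powers of the generators bounds the index of \<open>N\<close> in
  \<open>U\<close> from above, and being contained in the product set bounds it from below by the
  same number. Multiplicativity passes from \<open>U\<close> to \<open>G\<close>.\<close>

lemma index_procyclic_product:
  assumes U: "subgroup U G" "closedin T U"
    and gens: "uniform_gens (G\<lparr>carrier := U\<rparr>) (subtopology T U) p x [1..<Suc d]"
    and N: "N \<lhd> G" "openin T N" and N_eq: "N = procyclic_product G T d (\<lambda>k. x k [^] (p ^ m k))"
  shows "group_index G N = group_index G U * p ^ (\<Sum>k=1..d. m k)"
proof -
  let ?K = "G\<lparr>carrier := U\<rparr>" and ?S = "subtopology T U"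
  interpret K: uniform_gens ?K ?S p x "[1..<Suc d]" by (rule gens)
  have set: "set [1..<Suc d] = {1..d}" by auto
  have xU: "x k \<in> U" if "k \<in> {1..d}" for k
    using K.x_carrier[unfolded set, OF that] by simp
  have xpU: "x k [^] i \<in> U" if "k \<in> {1..d}" for k and i :: nat
    using xU[OF that] subgroup.m_closed[OF U(1)] subgroup.one_closed[OF U(1)] by (induction i) auto
  have NU: "N \<subseteq> U" unfolding N_eq using xpU by (intro procyclic_product_subset U)
  have NK: "N \<lhd> ?K"
    using normal_restrict_supergroup[OF U(1) N(1) NU] .
  have NS: "openin ?S N" using N(2) NU by (auto simp: openin_subtopology intro!: exI[of _ N])
  have mem: "x k [^]\<^bsub>?K\<^esub> (p ^ m k) \<in> N" if "k \<in> {1..d}" for k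
    using mem_procyclic_product[of d "\<lambda>k. x k [^] (p ^ m k)" k] that xpU
      subgroup.mem_carrier[OF U(1)] unfolding N_eq by (simp flip: nat_pow_consistent)
  have "card (rcosets\<^bsub>?K\<^esub> N) \<le> p ^ (\<Sum>k=1..d. m k)"
    using K.open_normal_index_le[OF NK NS, of m] mem unfolding set by blast
  moreover have "p ^ (\<Sum>k=1..d. m k) \<le> card (rcosets\<^bsub>?K\<^esub> N)"
  proof -
    have "N = procyclic_product ?K ?S d (\<lambda>k. x k [^]\<^bsub>?K\<^esub> (p ^ m k))"
      using procyclic_product_consistent[OF U, of d "\<lambda>k. x k [^] (p ^ m k)"] xpU
      unfolding N_eq by (simp flip: nat_pow_consistent)
    then have "N \<subseteq> foldr (\<lambda>k. (<#>\<^bsub>?K\<^esub>) (procyclic_subgroup ?K ?S (x k [^]\<^bsub>?K\<^esub> (p ^ m k)))) [1..<Suc d] {\<one>\<^bsub>?K\<^esub>}"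
      unfolding procyclic_product_def by simp
    then show ?thesis using K.open_normal_index_ge[OF NK NS] unfolding set by blast
  qed
  ultimately have "card (rcosets\<^bsub>?K\<^esub> N) = p ^ (\<Sum>k=1..d. m k)" by simp
  then show ?thesis
    using card_rcosets_mult[OF normal_imp_subgroup[OF N(1)] U(1) NU] by (simp add: group_index_def)
qed

text \<open>Positivity expresses that the index is finite, since \<open>card\<close> gives 0 for
  infinitely many cosets.\<close>

lemma group_index_mono:
  assumes "subgroup K G" "subgroup H G" "K \<subseteq> H" "group_index G K > 0"
  shows "group_index G H \<le> group_index G K" "group_index G H > 0"
  using card_rcosets_mult[OF assms(1-3)] assms(4) unfolding group_index_def by auto

end

section \<open>Rounding and the final estimate\<close>

lemma sum_floor_bounds:
  fixes a :: "nat \<Rightarrow> rat"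
  assumes "finite A"
  shows "(\<Sum>k\<in>A. \<lfloor>a k\<rfloor>) \<le> \<lfloor>\<Sum>k\<in>A. a k\<rfloor>" "\<lfloor>\<Sum>k\<in>A. a k\<rfloor> \<le> (\<Sum>k\<in>A. \<lfloor>a k\<rfloor>) + int (card A)"
proof -
  have "of_int (\<Sum>k\<in>A. \<lfloor>a k\<rfloor>) \<le> (\<Sum>k\<in>A. a k)"
    by (simp add: sum_mono)
  then show "(\<Sum>k\<in>A. \<lfloor>a k\<rfloor>) \<le> \<lfloor>\<Sum>k\<in>A. a k\<rfloor>" by (simp only: le_floor_iff)
  have "(\<Sum>k\<in>A. a k) \<le> (\<Sum>k\<in>A. of_int \<lfloor>a k\<rfloor> + 1)"
    by (intro sum_mono) linarith
  also have "\<dots> = of_int ((\<Sum>k\<in>A. \<lfloor>a k\<rfloor>) + int (card A))"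
    by (simp add: sum.distrib)
  finally show "\<lfloor>\<Sum>k\<in>A. a k\<rfloor> \<le> (\<Sum>k\<in>A. \<lfloor>a k\<rfloor>) + int (card A)"
    by (metis floor_mono floor_of_int)
qed

theorem corollary1p3:
  fixes G :: "('a, 'b) monoid_scheme" and T :: "'a topology"
    and p d j c :: nat and x :: "nat \<Rightarrow> 'a" and \<xi> :: "nat \<Rightarrow> rat" and \<sigma> :: rat
    and U :: "'a set" and lowerU upperU :: "nat \<Rightarrow> 'a set"
  assumes "prime p"
    and "pro_p_group p G T"
    and "padic_analytic_group p d G T"
    and "d \<ge> 1"
    and "j \<ge> 1"
    and U_def: "U = lower_p_series p G T j"
    and "uniformly_powerful p (G\<lparr>carrier := U\<rparr>) (subtopology T U)"
    and "minimal_generating_system (G\<lparr>carrier := U\<rparr>) (subtopology T U) d x"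
    and "1 / of_nat d \<le> \<xi> 1"
    and "\<And>k. 1 \<le> k \<Longrightarrow> k < d \<Longrightarrow> \<xi> k \<le> \<xi> (Suc k)"
    and "\<xi> d \<le> 1"
    and lowerU_def: "\<And>i. lowerU i = procyclic_product G T d
           (\<lambda>k. x k [^]\<^bsub>G\<^esub> (p ^ nat (\<lfloor>(of_nat i - of_nat j) * \<xi> k\<rfloor> + int c)))"
    and upperU_def: "\<And>i. upperU i = procyclic_product G T d
           (\<lambda>k. x k [^]\<^bsub>G\<^esub> (p ^ nat (\<lfloor>(of_nat i - of_nat j) * \<xi> k\<rfloor> - int c)))"
    and "\<And>i. 1 \<le> i \<Longrightarrow> i \<ge> max (j + 2 * c * d) (6 * c * d) \<Longrightarrow>
           openin T (lowerU i) \<and> lowerU i \<lhd> G \<and>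
           openin T (upperU i) \<and> upperU i \<lhd> G \<and>
           lowerU i \<subseteq> lower_p_series p G T i \<and> lower_p_series p G T i \<subseteq> upperU i \<and>
           homocyclic (G\<lparr>carrier := upperU i\<rparr> Mod lowerU i) \<and>
           group_exponent (G\<lparr>carrier := upperU i\<rparr> Mod lowerU i) = p ^ (2 * c)"
    and \<sigma>_def: "\<sigma> = (\<Sum>k=1..d. \<xi> k)"
  shows "1 \<le> \<sigma> \<and> \<sigma> \<le> of_nat d \<and>
         (\<forall>i. 1 \<le> i \<and> i \<ge> max (j + 2 * c * d) (6 * c * d) \<longrightarrow>
            \<bar>log (real p) (real (group_index G (lower_p_series p G T i))) -
              (log (real p) (real (group_index G (lower_p_series p G T j))) +
               real_of_int \<lfloor>(of_nat i - of_nat j) * \<sigma>\<rfloor>)\<bar>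
            \<le> real d * (real c + 1))"
proof (intro conjI allI impI)
  have tg: "topological_group G T" and cpt: "compact_space T"
    using assms(2) by (auto simp: pro_p_group_def profinite_group_def)
  interpret group G using tg by (simp add: topological_group_def)
  interpret topgroup G T using tg by unfold_locales
  have U: "subgroup U G" "closedin T U"
    unfolding U_def using normal_imp_subgroup[OF lps_normal] lps_closed by auto
  let ?K = "G\<lparr>carrier := U\<rparr>" and ?S = "subtopology T U"
  have set: "set [1..<Suc d] = {1..d}" by auto
  have gens: "uniform_gens ?K ?S p x [1..<Suc d]"
  proof (intro uniform_gens.intro uniform_pro_p.intro topgroup.intro topgroup_axioms.intro
      uniform_pro_p_axioms.intro uniform_gens_axioms.intro)
    show "group ?K" using subgroup_imp_group[OF U(1)] .
    show "topological_group ?K ?S"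
      using assms(7) by (simp add: uniformly_powerful_def pro_p_group_def profinite_group_def)
    show "topologically_generates ?K ?S (x ` set [1..<Suc d])"
      using assms(8) unfolding set minimal_generating_system_def by blast
    show "\<not> topologically_generates ?K ?S (x ` I)" if "I \<subset> set [1..<Suc d]" for I
      using assms(8) that unfolding set minimal_generating_system_def by blast
  qed (use assms(1,7) in auto)
  have \<xi>_le: "\<xi> k \<le> \<xi> k'" if "1 \<le> k" "k \<le> k'" "k' \<le> d" for k k'
    using that(2,1,3)
  proof (induction k' rule: dec_induct)
    case (step n)
    then have "\<xi> k \<le> \<xi> n" "\<xi> n \<le> \<xi> (Suc n)" using assms(10)[of n] by auto
    then show ?case by simp
  qed simp
  have \<xi>: "1 / of_nat d \<le> \<xi> k" "\<xi> k \<le> 1" if "k \<in> {1..d}" for k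
    using \<xi>_le[of 1 k] \<xi>_le[of k d] that assms(9,11) by auto
  have "(\<Sum>k=1..d. 1 / of_nat d :: rat) \<le> \<sigma>" "\<sigma> \<le> (\<Sum>k=1..d. 1)"
    unfolding \<sigma>_def using \<xi> by (intro sum_mono; simp)+
  then show "1 \<le> \<sigma>" "\<sigma> \<le> of_nat d" using assms(4) by auto
  fix i assume i: "1 \<le> i \<and> max (j + 2 * c * d) (6 * c * d) \<le> i"
  define P where "P = lower_p_series p G T i"
  define r :: "nat \<Rightarrow> int" where "r k = \<lfloor>(of_nat i - of_nat j) * \<xi> k\<rfloor>" for k
  note hyp = assms(14)[of i, folded P_def]
  have P: "subgroup P G" unfolding P_def using normal_imp_subgroup[OF lps_normal] .
  have L: "lowerU i \<lhd> G" "openin T (lowerU i)" "lowerU i \<subseteq> P"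
    and H: "upperU i \<lhd> G" "openin T (upperU i)" "P \<subseteq> upperU i"
    using hyp i by auto
  have index_L: "group_index G (lowerU i) = group_index G U * p ^ (\<Sum>k=1..d. nat (r k + int c))"
    by (rule index_procyclic_product[OF U gens L(1,2)]) (simp add: lowerU_def r_def)
  have index_H: "group_index G (upperU i) = group_index G U * p ^ (\<Sum>k=1..d. nat (r k - int c))"
    by (rule index_procyclic_product[OF U gens H(1,2)]) (simp add: upperU_def r_def)
  \<comment> \<open>From \<open>i \<ge> j + 2 * c * d\<close> and
    \<open>\<xi> k \<ge> 1 / d\<close>. Both \<open>r k + c\<close> and \<open>r k - c\<close> are
    therefore nonnegative, and \<open>nat\<close> truncates neither exponent.\<close>
  have r: "2 * int c \<le> r k" if "k \<in> {1..d}" for k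
  proof -
    have "of_nat (j + 2 * c * d) \<le> (of_nat i :: rat)" using i by (intro of_nat_mono) simp
    then have "2 * of_nat c * of_nat d \<le> (of_nat i - of_nat j :: rat)" by simp
    then have "(2 * of_nat c * of_nat d) * (1 / of_nat d) \<le> (of_nat i - of_nat j :: rat) * \<xi> k"
      using \<xi>[OF that] i by (intro mult_mono) auto
    then have "of_int (2 * int c) \<le> (of_nat i - of_nat j :: rat) * \<xi> k" using assms(4) by simp
    then show ?thesis unfolding r_def by (simp only: le_floor_iff)
  qed
  let ?R = "\<Sum>k=1..d. r k"
  have exps: "int (\<Sum>k=1..d. nat (r k + int c)) = ?R + int d * int c"
    "int (\<Sum>k=1..d. nat (r k - int c)) = ?R - int d * int c"
  proof -
    have "int (\<Sum>k=1..d. nat (r k + int c)) = (\<Sum>k=1..d. r k + int c)"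
      unfolding of_nat_sum using r by (intro sum.cong) force+
    then show "int (\<Sum>k=1..d. nat (r k + int c)) = ?R + int d * int c" by (simp add: sum.distrib)
    have "int (\<Sum>k=1..d. nat (r k - int c)) = (\<Sum>k=1..d. r k - int c)"
      unfolding of_nat_sum using r by (intro sum.cong) force+
    then show "int (\<Sum>k=1..d. nat (r k - int c)) = ?R - int d * int c" by (simp add: sum_subtractf)
  qed
  \<comment> \<open>An open subgroup of a compact group has finite index. From here positivity
    passes to the indices of the larger subgroups, as the logarithms require.\<close>
  have "group_index G (lowerU i) > 0"
    using open_subgroup_finite_index[OF cpt normal_imp_subgroup[OF L(1)] L(2)]
      rcosetsI[OF subgroup.subset[OF normal_imp_subgroup[OF L(1)]] one_closed]
    by (auto simp: group_index_def card_gt_0_iff)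
  then have up: "group_index G P \<le> group_index G (lowerU i)" and P0: "group_index G P > 0"
    using group_index_mono[OF normal_imp_subgroup[OF L(1)] P L(3)] by auto
  have low: "group_index G (upperU i) \<le> group_index G P" and H0: "group_index G (upperU i) > 0"
    using group_index_mono[OF P normal_imp_subgroup[OF H(1)] H(3) P0] by auto
  have U0: "group_index G U > 0" using H0 index_H by simp
  have p1: "real p > 1" using prime_gt_1_nat[OF assms(1)] by simp
  have log_mult_pow: "log (real p) (real (group_index G U * p ^ n)) =
      log (real p) (real (group_index G U)) + real n" for n
    using U0 p1 by (simp add: log_mult log_nat_power)
  have up': "log (real p) (real (group_index G P)) \<le>
      log (real p) (real (group_index G U)) + real_of_int (?R + int d * int c)"
  proof -
    have "log (real p) (real (group_index G P)) \<le> log (real p) (real (group_index G (lowerU i)))"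
      using up P0 p1 by (intro log_mono) auto
    then show ?thesis unfolding index_L log_mult_pow by (simp only: exps(1)[symmetric] of_int_of_nat_eq)
  qed
  have low': "log (real p) (real (group_index G U)) + real_of_int (?R - int d * int c) \<le>
      log (real p) (real (group_index G P))"
  proof -
    have "log (real p) (real (group_index G (upperU i))) \<le> log (real p) (real (group_index G P))"
      using low H0 p1 by (intro log_mono) auto
    then show ?thesis unfolding index_H log_mult_pow by (simp only: exps(2)[symmetric] of_int_of_nat_eq)
  qed
  let ?F = "\<lfloor>(of_nat i - of_nat j) * \<sigma>\<rfloor>"
  \<comment> \<open>Each of the \<open>d\<close> floors loses less than 1.\<close>
  have F: "?R \<le> ?F" "?F \<le> ?R + int d"
    using sum_floor_bounds[of "{1..d}" "\<lambda>k. (of_nat i - of_nat j) * \<xi> k"]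
    unfolding \<sigma>_def sum_distrib_left r_def by auto
  have "real_of_int ?R \<le> real_of_int ?F" "real_of_int ?F \<le> real_of_int ?R + real d"
    using F by linarith+
  \<comment> \<open>Above, the excess is at most \<open>d * c\<close> since
    \<open>?R \<le> ?F\<close>. Below, the shift \<open>d * c\<close> and the rounding loss
    \<open>d\<close> add up.\<close>
  then have "\<bar>log (real p) (real (group_index G P)) -
      (log (real p) (real (group_index G U)) + real_of_int ?F)\<bar> \<le> real d * (real c + 1)"
    using up' low' by (simp add: abs_le_iff algebra_simps)
  then show "\<bar>log (real p) (real (group_index G (lower_p_series p G T i))) -
      (log (real p) (real (group_index G (lower_p_series p G T j))) + real_of_int ?F)\<bar>
      \<le> real d * (real c + 1)"
    by (simp only: P_def U_def)
qed

end
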